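(* Assume $(\lambda_1,\dots,\lambda_d)\neq0$ and let $\rho$ be the unique positive real number with $\rho^d|\lambda_d|+\dots+\rho|\lambda_1|=1$. Then the power series $F_\lambda(r)=r+\sum_{k\ge2}v_k(2\pi)r^k$ (the return mapping, in the inverse form) converges at least on the complex disc $D(0,\rho/2)$.
   Context: Let $d\ge1$, let $\lambda=(\lambda_1,\dots,\lambda_d)$ be real parameters, and $p(x)=\sum_{i=1}^d\lambda_i x^i$. Consider the planar Liénard system $\dot x=y$, $\dot y=-x+p(x)y$. In polar coordinates $x=r\cos\theta$, $y=r\sin\theta$ its orbits satisfy $$\frac{dr}{d\theta}=\frac{r\,p(r\cos\theta)\sin^2\theta}{-1+\sin\theta\cos\theta\,p(r\cos\theta)}.$$ For small $r_0$ let $r(\theta;r_0)$ be the solution with $r(0;r_0)=r_0$; for each $\theta$ the inverse of $r_0\mapsto r(\theta;r_0)$ has the expansion $r_0=r+\sum_{k\ge2}v_k(\theta)r^k$, each $v_k(\theta)$ being a polynomial in $\lambda$. At $\theta=2\pi$ this is the inverse of the first return mapping. *)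

theory Defs
  imports "HOL-Analysis.Analysis"
begin

definition lien_p :: "nat \<Rightarrow> (nat \<Rightarrow> real) \<Rightarrow> real \<Rightarrow> real" where
  "lien_p d lam x = (\<Sum>i=1..d. lam i * x ^ i)"

definition polar_rhs :: "nat \<Rightarrow> (nat \<Rightarrow> real) \<Rightarrow> real \<Rightarrow> real \<Rightarrow> real" where
  "polar_rhs d lam \<theta> r =
     r * lien_p d lam (r * cos \<theta>) * (sin \<theta>)^2 /
       (-1 + sin \<theta> * cos \<theta> * lien_p d lam (r * cos \<theta>))"

definition is_polar_sol ::
  "nat \<Rightarrow> (nat \<Rightarrow> real) \<Rightarrow> real \<Rightarrow> real \<Rightarrow> (real \<Rightarrow> real) \<Rightarrow> bool" where
  "is_polar_sol d lam \<theta> r0 f \<longleftrightarrow>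
     f 0 = r0 \<and>
     (\<forall>t\<in>{min 0 \<theta>..max 0 \<theta>}.
        (f has_real_derivative polar_rhs d lam t (f t)) (at t within {min 0 \<theta>..max 0 \<theta>}))"

definition polar_sol :: "nat \<Rightarrow> (nat \<Rightarrow> real) \<Rightarrow> real \<Rightarrow> real \<Rightarrow> real" where
  "polar_sol d lam \<theta> r0 = (SOME f. is_polar_sol d lam \<theta> r0 f) \<theta>"

text \<open>A local inverse near 0 of r0 |-> r(theta; r0): continuous at 0, g 0 = 0,
  and r(theta; g r) = r for r near 0 (its germ at 0 is unique).\<close>
definition polar_sol_inv :: "nat \<Rightarrow> (nat \<Rightarrow> real) \<Rightarrow> real \<Rightarrow> real \<Rightarrow> real" where
  "polar_sol_inv d lam \<theta> = (SOME g. g 0 = 0 \<and> isCont g 0 \<and>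
       (\<forall>\<^sub>F r in nhds 0. polar_sol d lam \<theta> (g r) = r))"

definition vcoeff :: "nat \<Rightarrow> (nat \<Rightarrow> real) \<Rightarrow> nat \<Rightarrow> real \<Rightarrow> real" where
  "vcoeff d lam k \<theta> = (deriv ^^ k) (polar_sol_inv d lam \<theta>) 0 / fact k"

end

theory Submission
  imports Defs "HOL-Complex_Analysis.Complex_Analysis"
begin

text \<open>
  The inverse return map sends \<open>z\<close> to the radius at \<open>\<theta> = 0\<close> of the orbit with radius \<open>z\<close> at \<open>\<theta> = 2\<pi>\<close>, so
  one solves the complexified polar equation backwards. Rescale to \<open>\<rho> = 1\<close> and write
  \<open>1/r = 1/z + v\<close>. The equation for \<open>v\<close> is regular at \<open>z = 0\<close>, starts at \<open>v = 0\<close>, and for \<open>|z| < 1/2\<close>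
  the disc \<open>|v| \<le> 5/6\<close> (that is, \<open>|r| \<le> 6/7\<close>) is invariant under Picard iteration: the first-order
  contribution of the linear coefficient integrates to \<open>\<mu>\<^sub>1 sin\<^sup>3 \<tau> / 3\<close>, and what remains is small
  enough in absolute value. The iterates are holomorphic in \<open>z\<close> and converge uniformly, hence the
  inverse return map \<open>z / (1 + z v)\<close> is holomorphic in the disc. Uniqueness for the real equation
  identifies it with the germ whose Taylor coefficients are the \<open>v\<^sub>k(2\<pi>)\<close>.
\<close>

section \<open>Picard iteration with a holomorphic parameter\<close>

text \<open>Fubini on the product of a segment and a time interval. The integrability claim lets the
  three sides of a triangle be added under the time integral.\<close>

lemma contour_integral_linepath_integral_swap:
  fixes f :: "complex \<Rightarrow> real \<Rightarrow> complex"
  assumes cont: "continuous_on (U \<times> {a..b}) (\<lambda>(z, t). f z t)"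
    and sub: "closed_segment p q \<subseteq> U"
  shows "contour_integral (linepath p q) (\<lambda>z. integral {a..b} (f z)) =
         integral {a..b} (\<lambda>t. contour_integral (linepath p q) (\<lambda>z. f z t))"
    and "(\<lambda>t. contour_integral (linepath p q) (\<lambda>z. f z t)) integrable_on {a..b}"
proof -
  have lp: "linepath p q x \<in> U" if "x \<in> {0..1}" for x
    using sub that linepath_in_path by blast
  have c: "continuous_on ({0..1} \<times> {a..b}) (\<lambda>(x, t). f (linepath p q x) t * (q - p))"
    unfolding case_prod_beta
    by (intro continuous_intros continuous_on_compose2[OF cont[unfolded case_prod_beta],
          where f = "\<lambda>y. (linepath p q (fst y), snd y)", simplified])
       (auto intro!: lp continuous_on_compose2[OF continuous_on_linepath] continuous_intros)
  have c': "continuous_on (cbox (0, a) (1, b)) (\<lambda>(x, t). f (linepath p q x) t * (q - p))"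
    using c by (simp add: cbox_Pair_eq)
  have "continuous_on ({a..b} \<times> {0..1}) (\<lambda>(t, x). f (linepath p q x) t * (q - p))"
    using continuous_on_compose2[OF c continuous_on_swap, of "{a..b} \<times> {0..1}"]
    by (force simp: case_prod_beta)
  then have "continuous_on {a..b} (\<lambda>t. integral {0..1} (\<lambda>x. f (linepath p q x) t * (q - p)))"
    using integral_continuous_on_param[of "{a..b}" 0 "1::real" "\<lambda>t x. f (linepath p q x) t * (q - p)"]
    by simp
  then show "(\<lambda>t. contour_integral (linepath p q) (\<lambda>z. f z t)) integrable_on {a..b}"
    by (simp add: contour_integral_integral vector_derivative_linepath_at integrable_continuous_real)
  show "contour_integral (linepath p q) (\<lambda>z. integral {a..b} (f z)) =
         integral {a..b} (\<lambda>t. contour_integral (linepath p q) (\<lambda>z. f z t))"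
    using integral_swap_continuous[OF c']
    by (simp add: contour_integral_integral vector_derivative_linepath_at)
qed

text \<open>Morera's theorem: around a triangle the contour integral and the time integral can be
  exchanged, and for each fixed time the inner contour integral vanishes by Cauchy's
  theorem.\<close>

lemma holomorphic_on_integral_param:
  fixes f :: "complex \<Rightarrow> real \<Rightarrow> complex"
  assumes "open U"
    and cont: "continuous_on (U \<times> {a..b}) (\<lambda>(z, t). f z t)"
    and hol: "\<And>t. t \<in> {a..b} \<Longrightarrow> (\<lambda>z. f z t) holomorphic_on U"
  shows "(\<lambda>z. integral {a..b} (f z)) holomorphic_on U"
proof -
  have "(\<lambda>z. integral {a..b} (f z)) analytic_on U"
  proof (rule Morera_triangle)
    show "continuous_on U (\<lambda>z. integral {a..b} (f z))"
      using integral_continuous_on_param[of U a b f] cont by simp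
    show "open U" by fact
    show "convex hull {p, q, r} \<subseteq> U \<longrightarrow>
           contour_integral (linepath p q) (\<lambda>z. integral {a..b} (f z)) +
           contour_integral (linepath q r) (\<lambda>z. integral {a..b} (f z)) +
           contour_integral (linepath r p) (\<lambda>z. integral {a..b} (f z)) = 0" for p q r
    proof
      assume sub: "convex hull {p, q, r} \<subseteq> U"
      have seg: "closed_segment p q \<subseteq> U" "closed_segment q r \<subseteq> U" "closed_segment r p \<subseteq> U"
        using sub by (meson hull_subset insert_subset order_trans segments_subset_convex_hull)+
      note sw = contour_integral_linepath_integral_swap[OF cont]
      have zero: "contour_integral (linepath p q) (\<lambda>z. f z t) +
            contour_integral (linepath q r) (\<lambda>z. f z t) +
            contour_integral (linepath r p) (\<lambda>z. f z t) = 0" if t: "t \<in> {a..b}" for t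
      proof -
        have h: "(\<lambda>z. f z t) holomorphic_on convex hull {p, q, r}"
          using hol[OF t] sub holomorphic_on_subset by blast
        have i: "(\<lambda>z. f z t) contour_integrable_on linepath x y" if "closed_segment x y \<subseteq> U" for x y
          by (rule contour_integrable_continuous_linepath)
             (use hol[OF t] that in \<open>blast intro: continuous_on_subset holomorphic_on_imp_continuous_on\<close>)
        show ?thesis
          using contour_integral_unique[OF Cauchy_theorem_triangle[OF h]] seg
          by (simp add: i add.assoc)
      qed
      show "contour_integral (linepath p q) (\<lambda>z. integral {a..b} (f z)) +
           contour_integral (linepath q r) (\<lambda>z. integral {a..b} (f z)) +
           contour_integral (linepath r p) (\<lambda>z. integral {a..b} (f z)) = 0"
        using integral_unique[OF has_integral_is_0[of "{a..b}", OF zero]]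
        by (simp add: sw seg integrable_add flip: integral_add)
    qed
  qed
  then show ?thesis by (rule analytic_imp_holomorphic)
qed

lemma integral_rescale_unit:
  fixes f :: "real \<Rightarrow> complex"
  assumes "\<tau> \<ge> 0"
  shows "integral {0..\<tau>} f = \<tau> * integral {0..1} (\<lambda>x. f (\<tau> * x))"
proof (cases "\<tau> = 0")
  case False
  then have "(\<lambda>x. x / \<tau>) ` {0..\<tau>} = {0..1}"
    using assms by simp
  then show ?thesis
    using integral_stretch_real[of \<tau> 0 \<tau> f] False assms by (simp add: scaleR_conv_of_real)
qed auto

text \<open>Invariance of \<open>cball 0 V\<close> is assumed for integrals along arbitrary
  continuous curves, not for values of \<open>H\<close>, so that cancellation over time can be
  exploited. The Lipschitz bound makes the iterates converge uniformly; continuity, holomorphy in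
  \<open>z\<close> and real values pass to the limit.\<close>

theorem picard_holomorphic_parameter:
  fixes H :: "real \<Rightarrow> complex \<Rightarrow> complex \<Rightarrow> complex"
  assumes U: "open U" and T: "T \<ge> 0" and V: "V \<ge> 0" and L: "L \<ge> 0"
    and cont: "continuous_on ({0..T} \<times> U \<times> cball 0 V) (\<lambda>(t, z, v). H t z v)"
    and lip: "\<And>t z v w. t \<in> {0..T} \<Longrightarrow> z \<in> U \<Longrightarrow> v \<in> cball 0 V \<Longrightarrow> w \<in> cball 0 V \<Longrightarrow>
               norm (H t z v - H t z w) \<le> L * norm (v - w)"
    and hol: "\<And>t g. t \<in> {0..T} \<Longrightarrow> g holomorphic_on U \<Longrightarrow> g ` U \<subseteq> cball 0 V \<Longrightarrow>
               (\<lambda>z. H t z (g z)) holomorphic_on U"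
    and bound: "\<And>z w \<tau>. z \<in> U \<Longrightarrow> \<tau> \<in> {0..T} \<Longrightarrow> continuous_on {0..T} w \<Longrightarrow> w ` {0..T} \<subseteq> cball 0 V \<Longrightarrow>
               norm (integral {0..\<tau>} (\<lambda>t. H t z (w t))) \<le> V"
    and reals: "\<And>t z v. t \<in> {0..T} \<Longrightarrow> z \<in> U \<Longrightarrow> v \<in> cball 0 V \<Longrightarrow> z \<in> \<real> \<Longrightarrow> v \<in> \<real> \<Longrightarrow> H t z v \<in> \<real>"
  obtains v where
    "\<And>z. z \<in> U \<Longrightarrow> v z 0 = 0"
    "\<And>z \<tau>. z \<in> U \<Longrightarrow> \<tau> \<in> {0..T} \<Longrightarrow> norm (v z \<tau>) \<le> V"
    "\<And>z \<tau>. z \<in> U \<Longrightarrow> \<tau> \<in> {0..T} \<Longrightarrow>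
       (v z has_vector_derivative H \<tau> z (v z \<tau>)) (at \<tau> within {0..T})"
    "\<And>\<tau>. \<tau> \<in> {0..T} \<Longrightarrow> (\<lambda>z. v z \<tau>) holomorphic_on U"
    "\<And>z \<tau>. z \<in> U \<Longrightarrow> \<tau> \<in> {0..T} \<Longrightarrow> z \<in> \<real> \<Longrightarrow> v z \<tau> \<in> \<real>"
proof -
  \<comment> \<open>The Picard operator, rescaled to \<open>[0, 1]\<close> so that joint continuity and holomorphy are immediate.\<close>
  define P where "P w z \<tau> = of_real \<tau> * integral {0..1} (\<lambda>x. H (\<tau> * x) z (w z (\<tau> * x)))"
    for w :: "complex \<Rightarrow> real \<Rightarrow> complex" and z \<tau>
  \<comment> \<open>An invariant of \<open>P\<close>. Joint continuity is carried along because
    holomorphy of the parametric integral relies on it.\<close>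
  define good where "good w \<longleftrightarrow> continuous_on (U \<times> {0..T}) (\<lambda>(z, t). w z t) \<and>
      (\<forall>z\<in>U. \<forall>t\<in>{0..T}. w z t \<in> cball 0 V \<and> (z \<in> \<real> \<longrightarrow> w z t \<in> \<real>)) \<and>
      (\<forall>t\<in>{0..T}. (\<lambda>z. w z t) holomorphic_on U)" for w :: "complex \<Rightarrow> real \<Rightarrow> complex"
  have P_eq: "P w z \<tau> = integral {0..\<tau>} (\<lambda>t. H t z (w z t))" if "\<tau> \<in> {0..T}" for w z \<tau>
    unfolding P_def using integral_rescale_unit[of \<tau> "\<lambda>t. H t z (w z t)"] that by simp
  have scale: "\<tau> * x \<in> {0..T}" if "\<tau> \<in> {0..T}" "x \<in> {0..1}" for \<tau> x :: real
    using that mult_left_le[of x \<tau>] by (auto intro: order_trans)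
  have contw: "continuous_on {0..T} (w z)" if "continuous_on (U \<times> {0..T}) (\<lambda>(z, t). w z t)" "z \<in> U"
    for w :: "complex \<Rightarrow> real \<Rightarrow> complex" and z
    by (rule continuous_on_compose2[OF that(1), where f = "\<lambda>t. (z, t)", simplified])
       (use that in \<open>auto intro!: continuous_intros\<close>)
  have contH: "continuous_on {0..T} (\<lambda>t. H t z (w t))"
    if "z \<in> U" "continuous_on {0..T} w" "w ` {0..T} \<subseteq> cball 0 V" for z w
    by (rule continuous_on_compose2[OF cont, where f = "\<lambda>t. (t, z, w t)", simplified])
       (use that in \<open>auto intro!: continuous_intros\<close>)
  have good_P: "good (P w)" if w: "good w" for w
  proof -
    have cw: "continuous_on (U \<times> {0..T}) (\<lambda>y. w (fst y) (snd y))"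
      and bw: "\<And>z t. z \<in> U \<Longrightarrow> t \<in> {0..T} \<Longrightarrow> w z t \<in> cball 0 V"
      and rw: "\<And>z t. z \<in> U \<Longrightarrow> t \<in> {0..T} \<Longrightarrow> z \<in> \<real> \<Longrightarrow> w z t \<in> \<real>"
      and hw: "\<And>t. t \<in> {0..T} \<Longrightarrow> (\<lambda>z. w z t) holomorphic_on U"
      using w by (auto simp: good_def case_prod_beta)
    have cw2: "continuous_on ((U \<times> {0..T}) \<times> {0..1})
                 (\<lambda>y. w (fst (fst y)) (snd (fst y) * snd y))"
      by (rule continuous_on_compose2[OF cw, where f = "\<lambda>y. (fst (fst y), snd (fst y) * snd y)", simplified])
         (use scale in \<open>force intro!: continuous_intros\<close>)+
    have c: "continuous_on ((U \<times> {0..T}) \<times> {0..1})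
            (\<lambda>y. H (snd (fst y) * snd y) (fst (fst y)) (w (fst (fst y)) (snd (fst y) * snd y)))"
      by (rule continuous_on_compose2[OF cont, where f = "\<lambda>y. (snd (fst y) * snd y, fst (fst y), w (fst (fst y)) (snd (fst y) * snd y))", simplified])
         (use scale bw cw2 in \<open>force intro!: continuous_intros\<close>)+
    have c1: "continuous_on (U \<times> {0..T}) (\<lambda>(z, t). P w z t)"
      unfolding P_def case_prod_beta
      using integral_continuous_on_param[of "U \<times> {0..T}" 0 "1::real"
          "\<lambda>y x. H (snd y * x) (fst y) (w (fst y) (snd y * x))"] c
      by (intro continuous_intros) (simp add: case_prod_beta)
    have h: "(\<lambda>z. P w z t) holomorphic_on U" if t: "t \<in> {0..T}" for t
      unfolding P_def
    proof (intro holomorphic_intros holomorphic_on_integral_param U)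
      show "continuous_on (U \<times> {0..1}) (\<lambda>(z, x). H (t * x) z (w z (t * x)))"
        unfolding case_prod_beta
        by (rule continuous_on_compose2[OF c, where f = "\<lambda>y. ((fst y, t), snd y)", simplified])
           (use t in \<open>auto intro!: continuous_intros\<close>)
      show "(\<lambda>z. H (t * x) z (w z (t * x))) holomorphic_on U" if "x \<in> {0..1}" for x
        using scale[OF t that] bw hw by (intro hol) auto
    qed
    have b: "norm (P w z t) \<le> V" if "z \<in> U" "t \<in> {0..T}" for z t
      unfolding P_eq[OF that(2)] using that bw contw[of w z] w
      by (intro bound) (auto simp: good_def)
    have r: "P w z t \<in> \<real>" if "z \<in> U" "t \<in> {0..T}" "z \<in> \<real>" for z t
    proof -
      have "continuous_on {0..T} (\<lambda>s. H s z (w z s))"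
        using that bw contw[of w z] w by (intro contH) (auto simp: good_def)
      then have "(\<lambda>s. H s z (w z s)) integrable_on {0..t}"
        using that by (intro integrable_continuous_real) (auto elim: continuous_on_subset)
      from integral_linear[OF this bounded_linear_Im]
      have "Im (P w z t) = integral {0..t} (\<lambda>s. Im (H s z (w z s)))"
        using P_eq[OF that(2)] by (simp add: o_def)
      also have "\<dots> = integral {0..t} (\<lambda>s. 0)"
      proof (rule integral_cong)
        fix s assume "s \<in> {0..t}"
        then have "H s z (w z s) \<in> \<real>" using that bw rw by (intro reals) auto
        then show "Im (H s z (w z s)) = 0" by (simp add: complex_is_Real_iff)
      qed
      finally show ?thesis by (simp add: complex_is_Real_iff)
    qed
    show ?thesis unfolding good_def using c1 h b r by auto
  qed
  define v where "v n = (P ^^ n) (\<lambda>_ _. 0)" for n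
  have good_v: "good (v n)" for n
    by (induction n) (use V in \<open>auto simp: v_def good_P\<close>, auto simp: good_def)
  have v_Suc: "v (Suc n) = P (v n)" for n by (simp add: v_def)
  have bv: "\<And>n z t. z \<in> U \<Longrightarrow> t \<in> {0..T} \<Longrightarrow> v n z t \<in> cball 0 V"
    using good_v by (auto simp: good_def)
  have cv: "continuous_on {0..T} (v n z)" if "z \<in> U" for n z
    using good_v contw that by (auto simp: good_def)
  have cHv: "continuous_on {0..T} (\<lambda>t. H t z (v n z t))" if "z \<in> U" for n z
    using that cv bv by (intro contH) auto
  \<comment> \<open>Integrating the Lipschitz estimate once raises the power of \<open>t\<close> and
    improves the factorial, so the bounds sum to an exponential series. For \<open>n = 0\<close> the
    bound is \<open>V\<close> because the iteration starts at 0.\<close>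
  have diff: "norm (v (Suc n) z t - v n z t) \<le> V * (L * t) ^ n / fact n"
    if z: "z \<in> U" and t: "t \<in> {0..T}" for n z t
    using t
  proof (induction n arbitrary: t)
    case 0
    then show ?case using bv[OF z 0, of "Suc 0"] by (simp add: v_def)
  next
    case (Suc n)
    have i: "(\<lambda>s. H s z (v n z s)) integrable_on {0..t}" for n
      using Suc.prems
      by (auto intro!: integrable_continuous_real continuous_on_subset[OF cHv[OF z]])
    have g: "((\<lambda>s. L * (V * (L * s) ^ n / fact n)) has_integral V * (L * t) ^ Suc n / fact (Suc n)) {0..t}"
    proof -
      have "((\<lambda>s. V * (L * s) ^ Suc n / fact (Suc n)) has_real_derivative
              V * ((1 + real n) * (L * (L * s) ^ n)) / fact (Suc n)) (at s within {0..t})" for s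
        by (intro DERIV_cdivide DERIV_cmult DERIV_power_Suc) (auto intro!: derivative_eq_intros)
      moreover have "V * ((1 + real n) * (L * (L * s) ^ n)) / fact (Suc n) = L * (V * (L * s) ^ n / fact n)" for s
        by (simp add: divide_simps)
      ultimately have "((\<lambda>s. L * (V * (L * s) ^ n / fact n)) has_integral
          V * (L * t) ^ Suc n / fact (Suc n) - V * (L * 0) ^ Suc n / fact (Suc n)) {0..t}"
        using Suc.prems
        by (intro fundamental_theorem_of_calculus)
           (auto simp flip: has_real_derivative_iff_has_vector_derivative simp del: power_Suc fact_Suc)
      then show ?thesis by simp
    qed
    have "norm (v (Suc (Suc n)) z t - v (Suc n) z t) =
          norm (integral {0..t} (\<lambda>s. H s z (v (Suc n) z s) - H s z (v n z s)))"
      unfolding integral_diff[OF i i] v_Suc[of "Suc n"] v_Suc[of n, symmetric]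
      using Suc.prems by (metis P_eq v_Suc)
    also have "\<dots> \<le> integral {0..t} (\<lambda>s. L * (V * (L * s) ^ n / fact n))"
    proof (rule integral_norm_bound_integral)
      show "(\<lambda>s. H s z (v (Suc n) z s) - H s z (v n z s)) integrable_on {0..t}"
        using i by (intro integrable_diff)
      show "(\<lambda>s. L * (V * (L * s) ^ n / fact n)) integrable_on {0..t}" using g by blast
      fix s assume "s \<in> {0..t}"
      then have s: "s \<in> {0..T}" using Suc.prems by auto
      have "norm (H s z (v (Suc n) z s) - H s z (v n z s)) \<le> L * norm (v (Suc n) z s - v n z s)"
        using s z bv by (intro lip) auto
      also have "\<dots> \<le> L * (V * (L * s) ^ n / fact n)"
        using Suc.IH[OF s] L by (intro mult_left_mono)
      finally show "norm (H s z (v (Suc n) z s) - H s z (v n z s)) \<le> L * (V * (L * s) ^ n / fact n)" .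
    qed
    also have "\<dots> = V * (L * t) ^ Suc n / fact (Suc n)" using g by (rule integral_unique)
    finally show ?case .
  qed
  \<comment> \<open>The limit is written as a telescoping series so that the M-test applies to the
    differences; the partial sums are the iterates because \<open>v 0\<close> vanishes.\<close>
  define w where "w z t = (\<Sum>n. v (Suc n) z t - v n z t)" for z t
  have "uniform_limit (U \<times> {0..T}) (\<lambda>n y. \<Sum>i<n. v (Suc i) (fst y) (snd y) - v i (fst y) (snd y))
          (\<lambda>y. w (fst y) (snd y)) sequentially"
    unfolding w_def
  proof (rule Weierstrass_m_test)
    show "summable (\<lambda>n. V * (L * T) ^ n / fact n)"
      using summable_mult[OF summable_exp[of "L * T"], of V] by (simp add: field_simps)
    fix n y assume y: "y \<in> U \<times> {0..T}"
    have "norm (v (Suc n) (fst y) (snd y) - v n (fst y) (snd y)) \<le> V * (L * snd y) ^ n / fact n"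
      using y by (intro diff) auto
    also have "\<dots> \<le> V * (L * T) ^ n / fact n"
      using y L V by (intro divide_right_mono mult_left_mono power_mono) auto
    finally show "norm (v (Suc n) (fst y) (snd y) - v n (fst y) (snd y)) \<le> V * (L * T) ^ n / fact n" .
  qed
  then have ul: "uniform_limit (U \<times> {0..T}) (\<lambda>n y. v n (fst y) (snd y)) (\<lambda>y. w (fst y) (snd y)) sequentially"
    using sum_lessThan_telescope[of "\<lambda>i. v i z t" for z t] by (simp add: v_def del: funpow.simps(2))
  have lim: "(\<lambda>n. v n z t) \<longlonglongrightarrow> w z t" if "z \<in> U" "t \<in> {0..T}" for z t
    using tendsto_uniform_limitI[OF ul, of "(z, t)"] that by simp
  have bw: "w z t \<in> cball 0 V" if "z \<in> U" "t \<in> {0..T}" for z t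
    by (rule Lim_in_closed_set[OF closed_cball _ _ lim[OF that]]) (use bv[OF that] in auto)
  have rw: "w z t \<in> \<real>" if "z \<in> U" "t \<in> {0..T}" "z \<in> \<real>" for z t
    by (rule Lim_in_closed_set[OF closed_complex_Reals _ _ lim[OF that(1,2)]])
       (use good_v that in \<open>auto simp: good_def\<close>)
  have cw: "continuous_on (U \<times> {0..T}) (\<lambda>(z, t). w z t)"
    unfolding case_prod_beta
    by (rule uniform_limit_theorem[OF _ ul]) (use good_v in \<open>auto simp: good_def case_prod_beta\<close>)
  have hw: "(\<lambda>z. w z t) holomorphic_on U" if t: "t \<in> {0..T}" for t
  proof (rule holomorphic_uniform_sequence[OF U])
    show "(\<lambda>z. v n z t) holomorphic_on U" for n using good_v t by (auto simp: good_def)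
    fix z assume "z \<in> U"
    then obtain d where d: "d > 0" "cball z d \<subseteq> U" using U open_contains_cball by blast
    moreover have "uniform_limit (cball z d) (\<lambda>n z. v n z t) (\<lambda>z. w z t) sequentially"
      using uniform_limit_compose'[OF ul, of "\<lambda>z. (z, t)" "cball z d"] d t by (auto simp: Pi_iff subset_iff)
    ultimately show "\<exists>d>0. cball z d \<subseteq> U \<and> uniform_limit (cball z d) (\<lambda>n z. v n z t) (\<lambda>z. w z t) sequentially"
      by blast
  qed
  have cHw: "continuous_on {0..T} (\<lambda>t. H t z (w z t))" if "z \<in> U" for z
    using that contw[OF cw] bw by (intro contH) auto
  have eq: "w z \<tau> = integral {0..\<tau>} (\<lambda>t. H t z (w z t))" if z: "z \<in> U" and \<tau>: "\<tau> \<in> {0..T}" for z \<tau>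
  proof -
    have "uniform_limit (cbox 0 \<tau>) (\<lambda>n t. H t z (v n z t)) (\<lambda>t. H t z (w z t)) sequentially"
    proof (rule uniform_limitI)
      fix e :: real assume "e > 0"
      \<comment> \<open>The divisor \<open>L + 1\<close> instead of \<open>L\<close> covers the case
        \<open>L = 0\<close>.\<close>
      then have "e / (L + 1) > 0" using L by simp
      from uniform_limitD[OF ul this]
      show "\<forall>\<^sub>F n in sequentially. \<forall>t\<in>cbox 0 \<tau>. dist (H t z (v n z t)) (H t z (w z t)) < e"
      proof eventually_elim
        case (elim n)
        show ?case
        proof
          fix t assume "t \<in> cbox 0 \<tau>"
          then have t: "t \<in> {0..T}" using \<tau> by auto
          have "norm (v n z t - w z t) < e / (L + 1)"
            using elim z t by (auto simp: dist_norm)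
          then have "(L + 1) * norm (v n z t - w z t) < e" using L by (simp add: field_simps)
          moreover have "norm (H t z (v n z t) - H t z (w z t)) \<le> L * norm (v n z t - w z t)"
            using t z bv bw by (intro lip) auto
          ultimately show "dist (H t z (v n z t)) (H t z (w z t)) < e"
            by (smt (verit) dist_norm distrib_right mult_cancel_right1 norm_ge_zero mult_1)
        qed
      qed
    qed
    then obtain I J where I: "\<And>n. ((\<lambda>t. H t z (v n z t)) has_integral I n) (cbox 0 \<tau>)"
      "((\<lambda>t. H t z (w z t)) has_integral J) (cbox 0 \<tau>)" "I \<longlonglongrightarrow> J"
      by (rule uniform_limit_integral_cbox)
         (use \<tau> in \<open>auto intro!: continuous_on_subset[OF cHv[OF z]]\<close>)
    have "I n = v (Suc n) z \<tau>" for n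
      using I(1)[of n] \<tau> by (simp add: v_Suc P_eq integral_unique)
    then have "I = (\<lambda>n. v (Suc n) z \<tau>)" by blast
    then have "I \<longlonglongrightarrow> w z \<tau>" using LIMSEQ_Suc[OF lim[OF z \<tau>]] by simp
    then have "J = w z \<tau>" using I(3) LIMSEQ_unique by blast
    then show ?thesis using I(2) by (simp add: integral_unique)
  qed
  show thesis
  proof (rule that[of w])
    show "w z 0 = 0" if "z \<in> U" for z using eq[OF that, of 0] T by simp
    show "norm (w z \<tau>) \<le> V" if "z \<in> U" "\<tau> \<in> {0..T}" for z \<tau> using bw[OF that] by simp
    show "(w z has_vector_derivative H \<tau> z (w z \<tau>)) (at \<tau> within {0..T})"
      if "z \<in> U" "\<tau> \<in> {0..T}" for z \<tau>
      by (rule has_vector_derivative_transform[OF that(2) _ integral_has_vector_derivative[OF cHw[OF that(1)] that(2)]])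
         (use that eq in auto)
  qed (use hw rw in auto)
qed

section \<open>Estimates for the inverse radius\<close>

text \<open>The exact maximum is 2/(3 sqrt 3). The slightly larger 7/18 is chosen because its
  product with the radius bound 6/7 is 1/3.\<close>

lemma sin_cos_sq_bound:
  fixes x y :: real
  assumes "x\<^sup>2 + y\<^sup>2 = 1"
  shows "\<bar>x\<bar> * y\<^sup>2 \<le> 7 / 18"
proof -
  define u where "u = \<bar>x\<bar>"
  have "x\<^sup>2 \<le> 1" using assms zero_le_power2[of y] by linarith
  then have u: "0 \<le> u" "u \<le> 1" by (simp_all add: u_def abs_square_le_1)
  have "0 \<le> (u - 15/26)\<^sup>2 * (u + 15/13)" using u by simp
  also have "\<dots> = u ^ 3 - 675/676 * u + (15/26)\<^sup>2 * (15/13)"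
    by (simp add: power2_eq_square power3_eq_cube field_simps)
  finally have "u - u ^ 3 \<le> 7 / 18" using u by (simp add: power2_eq_square)
  moreover have "y\<^sup>2 = 1 - u\<^sup>2" using assms by (simp add: u_def)
  ultimately show ?thesis
    unfolding u_def[symmetric] by (simp add: right_diff_distrib power2_eq_square power3_eq_cube)
qed

text \<open>A weighted AM-GM step reduces the claim to a quadratic in y^2 with vertex 49/66. The
  exact maximum is 3 sqrt 3 / 16; the constant 49/144 is chosen because its product with (6/7)^2 is
  1/4.\<close>

lemma sin_cos_cube_bound:
  fixes x y :: real
  assumes "x\<^sup>2 + y\<^sup>2 = 1"
  shows "\<bar>x\<bar> * \<bar>y\<bar> ^ 3 \<le> 49 / 144"
proof -
  \<comment> \<open>The weights 7 and 4 approximate the ratio sqrt 3 of |y| to |x| at the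
    maximum.\<close>
  have "0 \<le> (7 * \<bar>x\<bar> - 4 * \<bar>y\<bar>)\<^sup>2" by simp
  then have "56 * (\<bar>x\<bar> * \<bar>y\<bar>) \<le> 49 * x\<^sup>2 + 16 * y\<^sup>2"
    by (simp add: power2_diff power_mult_distrib mult.assoc)
  also have "\<dots> = 49 - 33 * y\<^sup>2" using assms by simp
  finally have "56 * (\<bar>x\<bar> * \<bar>y\<bar>) * y\<^sup>2 \<le> (49 - 33 * y\<^sup>2) * y\<^sup>2"
    by (intro mult_right_mono) auto
  also have "\<dots> \<le> 56 * (49 / 144)"
    using zero_le_power2[of "y\<^sup>2 - 49/66"] by (simp add: power2_eq_square algebra_simps)
  finally show ?thesis by (simp add: power2_eq_square power3_eq_cube algebra_simps abs_mult_self_eq)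
qed

text \<open>Convexity of X^2/(1 - \<gamma> X) between X = 1 and X = \<beta>. It gives the linear
  coefficient and the higher ones separate denominators, and keeps the resulting bound affine in the
  weights.\<close>

lemma square_over_affine_convex:
  fixes a b \<beta> \<gamma> :: real
  assumes "a \<ge> 0" "b \<ge> 0" "a + b = 1" "\<gamma> < 1" "\<gamma> * \<beta> < 1"
  shows "(a + b * \<beta>)\<^sup>2 / (1 - \<gamma> * (a + b * \<beta>)) \<le> a / (1 - \<gamma>) + b * \<beta>\<^sup>2 / (1 - \<gamma> * \<beta>)"
proof -
  define p q where "p = 1 - \<gamma>" and "q = 1 - \<gamma> * \<beta>"
  have pq: "p > 0" "q > 0" using assms by (auto simp: p_def q_def)
  have e: "1 - \<gamma> * (a + b * \<beta>) = a * p + b * q"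
    using assms(3) unfolding p_def q_def by algebra
  have pos: "a * p + b * q > 0"
    using assms pq by (metis add_nonneg_pos add_pos_nonneg less_eq_real_def mult_eq_0_iff mult_nonneg_nonneg mult_pos_pos zero_neq_one add_0)
  \<comment> \<open>With denominators cleared, the gap in the inequality is exactly a b (q - \<beta>
    p)^2.\<close>
  have "(a + b * \<beta>)\<^sup>2 * (p * q) + a * b * (q - \<beta> * p)\<^sup>2 = (a * q + b * \<beta>\<^sup>2 * p) * (a * p + b * q)"
    by (simp add: power2_eq_square algebra_simps)
  moreover have "0 \<le> a * b * (q - \<beta> * p)\<^sup>2" using assms by simp
  ultimately have "(a + b * \<beta>)\<^sup>2 * (p * q) \<le> (a * q + b * \<beta>\<^sup>2 * p) * (a * p + b * q)" by linarith
  then have "(a + b * \<beta>)\<^sup>2 / (a * p + b * q) \<le> (a * q + b * \<beta>\<^sup>2 * p) / (p * q)"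
    using pos pq by (simp add: divide_le_eq pos_le_divide_eq mult.commute)
  also have "\<dots> = a / p + b * \<beta>\<^sup>2 / q" using pq by (simp add: field_simps)
  finally show ?thesis unfolding e p_def q_def .
qed

section \<open>The rate of the inverse radius and its majorant\<close>

definition lien_quot :: "nat \<Rightarrow> (nat \<Rightarrow> real) \<Rightarrow> complex \<Rightarrow> complex" where
  "lien_quot d \<mu> x = (\<Sum>i=1..d. of_real (\<mu> i) * x ^ (i - 1))"

text \<open>With \<open>\<tau> = 2\<pi> - \<theta>\<close> running backwards in the angle, this is \<open>d(1/r)/d\<tau>\<close> along the orbits;
  \<open>lien_quot\<close> is \<open>p(x)/x\<close>, so the formula makes sense at \<open>r = 0\<close>.\<close>
definition inv_radius_rate :: "nat \<Rightarrow> (nat \<Rightarrow> real) \<Rightarrow> real \<Rightarrow> complex \<Rightarrow> complex" where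
  "inv_radius_rate d \<mu> \<tau> r =
     - of_real (cos \<tau> * (sin \<tau>)\<^sup>2) * lien_quot d \<mu> (r * of_real (cos \<tau>)) /
       (1 + of_real (sin \<tau> * (cos \<tau>)\<^sup>2) * r * lien_quot d \<mu> (r * of_real (cos \<tau>)))"

text \<open>Bounds the part of the rate that survives after removing \<open>- \<mu>\<^sub>1 cos \<tau> sin\<^sup>2 \<tau>\<close> when \<open>|r| \<le> 6/7\<close>.
  The odd power \<open>|sin \<tau> cos \<tau>|\<^sup>3\<close> has been replaced by the smooth bound
  \<open>w\<^sup>3 \<le> (\<kappa> w\<^sup>2 + w\<^sup>4 / \<kappa>) / 2\<close> with \<open>\<kappa> = 3/7\<close>, and everything is written in the angle \<open>2\<tau>\<close>.\<close>
definition rate_majorant :: "real \<Rightarrow> real \<Rightarrow> real" where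
  "rate_majorant a t = (1 - a) * (6/7) * ((sin (2*t))\<^sup>2 / 4) +
     (6/7) * (3/2 * a + (1 - a) * (6/7)\<^sup>2 * (2/3) * (1 + cos (2*t))) *
     (3/56 * (sin (2*t))\<^sup>2 + 7/96 * (sin (2*t)) ^ 4)"

lemma rate_majorant_nonneg:
  assumes "0 \<le> a" "a \<le> 1"
  shows "0 \<le> rate_majorant a t"
proof -
  define C where "C = 1 + cos (2*t)"
  have "0 \<le> C" using cos_ge_minus_one[of "2*t"] unfolding C_def by linarith
  then show ?thesis
    unfolding rate_majorant_def C_def[symmetric] using assms
    by (intro add_nonneg_nonneg mult_nonneg_nonneg) auto
qed

text \<open>Once the linear term is removed, two errors remain: the tail q - \<open>\<mu> 1\<close>,
  whose summands all carry a factor r cos t, and the remainder in q/(1 + kq) = q - k q^2/(1 + kq).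
  The second claim keeps the denominator of the rate away from 0.\<close>

lemma inv_radius_rate_bound:
  assumes sum1: "(\<Sum>i=1..d. \<bar>\<mu> i\<bar>) = 1" and d: "d \<ge> 1" and r: "norm r \<le> 6/7"
  shows "norm (inv_radius_rate d \<mu> t r + of_real (\<mu> 1 * cos t * (sin t)\<^sup>2)) \<le> rate_majorant \<bar>\<mu> 1\<bar> t"
    and "norm (of_real (sin t * (cos t)\<^sup>2) * r * lien_quot d \<mu> (r * of_real (cos t))) \<le> 1/3"
proof -
  define s c a b R where "s = sin t" and "c = cos t" and "a = \<bar>\<mu> 1\<bar>" and "b = 1 - a" and "R = (6/7::real)"
  \<comment> \<open>\<open>\<beta>\<close> will bound |r cos t|, and \<open>\<gamma>\<close> will
    bound the factor \<open>k\<close> of \<open>q\<close> in the denominator.\<close>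
  define \<beta> \<gamma> where "\<beta> = R * \<bar>c\<bar>" and "\<gamma> = R * (\<bar>s\<bar> * c\<^sup>2)"
  define q k where "q = lien_quot d \<mu> (r * of_real c)" and "k = of_real (s * c\<^sup>2) * r"
  have sc: "s\<^sup>2 + c\<^sup>2 = 1" by (simp add: s_def c_def)
  have split: "{1..d} = insert 1 {2..d}" using d by auto
  have b: "b = (\<Sum>i=2..d. \<bar>\<mu> i\<bar>)" using sum1 unfolding split by (simp add: b_def a_def)
  have ab: "0 \<le> a" "0 \<le> b" "a + b = 1" by (simp_all add: a_def b sum_nonneg) (simp add: b_def a_def flip: b)
  have \<beta>: "0 \<le> \<beta>" "\<beta> \<le> 1" using abs_cos_le_one[of t] unfolding \<beta>_def R_def c_def by linarith+
  have x: "norm (r * of_real c) \<le> \<beta>"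
    using mult_right_mono[OF r, of "\<bar>c\<bar>"] by (simp add: \<beta>_def R_def norm_mult)
  have q1: "norm (q - of_real (\<mu> 1)) \<le> b * \<beta>"
  proof -
    have "q - of_real (\<mu> 1) = (\<Sum>i=2..d. of_real (\<mu> i) * (r * of_real c) ^ (i - 1))"
      unfolding q_def lien_quot_def split by simp
    also have "norm \<dots> \<le> (\<Sum>i=2..d. \<bar>\<mu> i\<bar> * \<beta>)"
    proof (rule sum_norm_le)
      fix i assume i: "i \<in> {2..d}"
      have "norm (r * of_real c) ^ (i - 1) \<le> \<beta> ^ (i - 1)" using x by (intro power_mono) auto
      also have "\<dots> \<le> \<beta> ^ 1" using i \<beta> by (intro power_decreasing) auto
      finally show "norm (of_real (\<mu> i) * (r * of_real c) ^ (i - 1)) \<le> \<bar>\<mu> i\<bar> * \<beta>"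
        by (simp add: norm_mult norm_power mult_left_mono)
    qed
    finally show ?thesis by (simp add: b sum_distrib_right)
  qed
  have qX: "norm q \<le> a + b * \<beta>"
    using norm_triangle_ineq[of "q - of_real (\<mu> 1)" "of_real (\<mu> 1)"] q1 by (simp add: a_def)
  have X1: "0 \<le> a + b * \<beta>" "a + b * \<beta> \<le> 1" using ab \<beta> mult_left_le[of \<beta> b] by auto
  have \<gamma>: "0 \<le> \<gamma>" "\<gamma> \<le> 1/3"
    using sin_cos_sq_bound[OF sc] by (auto simp: \<gamma>_def R_def)
  have \<gamma>\<beta>: "\<gamma> * \<beta> \<le> 1/4"
    using sin_cos_cube_bound[OF sc]
    by (simp add: \<gamma>_def \<beta>_def R_def power2_eq_square power3_eq_cube algebra_simps abs_mult_self_eq)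
  have k: "norm k \<le> \<gamma>"
  proof -
    have "norm k = (\<bar>s\<bar> * c\<^sup>2) * norm r" by (simp add: k_def norm_mult abs_mult norm_power)
    also have "\<dots> \<le> (\<bar>s\<bar> * c\<^sup>2) * R" using r by (intro mult_left_mono) (auto simp: R_def)
    finally show ?thesis by (simp add: \<gamma>_def mult.commute)
  qed
  have kq: "norm (k * q) \<le> \<gamma> * (a + b * \<beta>)"
    using k qX \<gamma> by (simp add: norm_mult mult_mono)
  also have *: "\<dots> \<le> 1/3 * 1" using \<gamma> X1 by (intro mult_mono) auto
  finally have kq3: "norm (k * q) \<le> 1/3" by simp
  then show "norm (of_real (sin t * (cos t)\<^sup>2) * r * lien_quot d \<mu> (r * of_real (cos t))) \<le> 1/3"
    by (simp add: k_def q_def s_def c_def)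
  have den: "1 - \<gamma> * (a + b * \<beta>) \<le> norm (1 + k * q)"
    using kq norm_triangle_ineq2[of 1 "- (k * q)"] by simp
  have nz: "1 + k * q \<noteq> 0" using den * by auto
  have "inv_radius_rate d \<mu> t r + of_real (\<mu> 1 * cos t * (sin t)\<^sup>2) =
        - (of_real (c * s\<^sup>2) * ((q - of_real (\<mu> 1)) - k * (q\<^sup>2 / (1 + k * q))))"
    unfolding inv_radius_rate_def s_def[symmetric] c_def[symmetric] q_def[symmetric] k_def[symmetric]
    using nz by (simp add: divide_simps) (simp add: algebra_simps power2_eq_square)
  then have "norm (inv_radius_rate d \<mu> t r + of_real (\<mu> 1 * cos t * (sin t)\<^sup>2)) =
        \<bar>c\<bar> * s\<^sup>2 * norm ((q - of_real (\<mu> 1)) - k * (q\<^sup>2 / (1 + k * q)))"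
    by (simp add: norm_mult norm_power abs_mult)
  also have "\<dots> \<le> \<bar>c\<bar> * s\<^sup>2 * (b * \<beta> + \<gamma> * (3/2 * a + 4/3 * (b * \<beta>\<^sup>2)))"
  proof (rule mult_left_mono)
    have "norm (q\<^sup>2 / (1 + k * q)) \<le> (a + b * \<beta>)\<^sup>2 / (1 - \<gamma> * (a + b * \<beta>))"
      unfolding norm_divide norm_power
      using den * qX by (intro frac_le power_mono) auto
    also have "\<dots> \<le> a / (1 - \<gamma>) + b * \<beta>\<^sup>2 / (1 - \<gamma> * \<beta>)"
      using ab \<gamma> \<gamma>\<beta> by (intro square_over_affine_convex) auto
    \<comment> \<open>The denominators are 1 - 1/3 and 1 - 1/4, from the bounds on
      \<open>\<gamma>\<close> and on \<open>\<gamma> * \<beta>\<close>.\<close>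
    also have "\<dots> \<le> a / (2/3) + b * \<beta>\<^sup>2 / (3/4)"
      using ab \<gamma> \<gamma>\<beta> by (intro add_mono divide_left_mono) auto
    finally have "norm (q\<^sup>2 / (1 + k * q)) \<le> 3/2 * a + 4/3 * (b * \<beta>\<^sup>2)" by simp
    then have "norm (k * (q\<^sup>2 / (1 + k * q))) \<le> \<gamma> * (3/2 * a + 4/3 * (b * \<beta>\<^sup>2))"
      unfolding norm_mult using k \<gamma> by (intro mult_mono) auto
    then show "norm ((q - of_real (\<mu> 1)) - k * (q\<^sup>2 / (1 + k * q))) \<le> b * \<beta> + \<gamma> * (3/2 * a + 4/3 * (b * \<beta>\<^sup>2))"
      using q1 norm_triangle_ineq4[of "q - of_real (\<mu> 1)" "k * (q\<^sup>2 / (1 + k * q))"] by linarith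
  qed auto
  also have "\<dots> = b * R * (s * c)\<^sup>2 + R * (3/2 * a + b * R\<^sup>2 * (4/3) * c\<^sup>2) * \<bar>s * c\<bar> ^ 3"
  proof -
    have sq: "s\<^sup>2 = \<bar>s\<bar>\<^sup>2" "c\<^sup>2 = \<bar>c\<bar>\<^sup>2" by simp_all
    have e1: "\<bar>c\<bar> * s\<^sup>2 * (b * \<beta>) = b * R * (s * c)\<^sup>2"
      unfolding \<beta>_def power_mult_distrib sq by algebra
    have e2: "\<bar>c\<bar> * s\<^sup>2 * \<gamma> = R * \<bar>s * c\<bar> ^ 3"
      unfolding \<gamma>_def abs_mult sq by algebra
    have e3: "\<beta>\<^sup>2 = R\<^sup>2 * c\<^sup>2" by (simp add: \<beta>_def power_mult_distrib)
    have "\<bar>c\<bar> * s\<^sup>2 * (b * \<beta> + \<gamma> * Y) = \<bar>c\<bar> * s\<^sup>2 * (b * \<beta>) + \<bar>c\<bar> * s\<^sup>2 * \<gamma> * Y" for Y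
      by (simp add: distrib_left mult.assoc)
    then show ?thesis by (simp only: e1 e2 e3) simp
  qed
  also have "\<dots> \<le> b * R * (s * c)\<^sup>2 + R * (3/2 * a + b * R\<^sup>2 * (4/3) * c\<^sup>2) *
      (3/14 * (s * c)\<^sup>2 + 7/6 * (s * c) ^ 4)"
  proof (intro add_left_mono mult_left_mono)
    have w: "(s * c)\<^sup>2 = \<bar>s * c\<bar>\<^sup>2" "(s * c) ^ 4 = \<bar>s * c\<bar> ^ 4" by (simp_all add: power_even_abs)
    \<comment> \<open>The gap is 1/(2 \<kappa>) times x^2 (x - \<kappa>)^2 with \<kappa> = 3/7,
      hence nonnegative.\<close>
    have poly: "7/6 * (x\<^sup>2 * (x - 3/7)\<^sup>2) = 3/14 * x\<^sup>2 + 7/6 * x ^ 4 - x ^ 3" for x :: real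
      by (simp add: power2_eq_square power3_eq_cube power4_eq_xxxx field_simps)
    have "0 \<le> 7/6 * ((s * c)\<^sup>2 * (\<bar>s * c\<bar> - 3/7)\<^sup>2)" by simp
    also have "\<dots> = 3/14 * (s * c)\<^sup>2 + 7/6 * (s * c) ^ 4 - \<bar>s * c\<bar> ^ 3"
      unfolding w by (rule poly)
    finally show "\<bar>s * c\<bar> ^ 3 \<le> 3/14 * (s * c)\<^sup>2 + 7/6 * (s * c) ^ 4" by simp
    show "0 \<le> R * (3/2 * a + b * R\<^sup>2 * (4/3) * c\<^sup>2)" using ab by (simp add: R_def)
  qed
  also have "\<dots> = rate_majorant \<bar>\<mu> 1\<bar> t"
  proof -
    \<comment> \<open>Since s c is half of sin (2t), the coefficients 3/14 and 7/6 become 3/56 and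
      7/96.\<close>
    have "sin (2 * t) = 2 * (s * c)" "1 + cos (2 * t) = 2 * c\<^sup>2"
      by (simp_all add: sin_double cos_double_cos s_def c_def)
    then show ?thesis
      unfolding rate_majorant_def a_def[symmetric] b_def[symmetric] R_def
      by (simp add: power_mult_distrib) (simp add: mult.commute)
  qed
  finally show "norm (inv_radius_rate d \<mu> t r + of_real (\<mu> 1 * cos t * (sin t)\<^sup>2)) \<le> rate_majorant \<bar>\<mu> 1\<bar> t" .
qed

text \<open>The slack a/3 below 5/6 is reserved for the linear term, which is integrated exactly
  elsewhere. The integral is affine in \<open>a\<close>, so it suffices to compare the end values:
  about 0.816 against 5/6 at a = 0, and about 0.437 against 1/2 at a = 1.\<close>

lemma rate_majorant_integral:
  assumes "0 \<le> a" "a \<le> 1"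
  shows "integral {0..2*pi} (rate_majorant a) \<le> 5/6 - a/3"
proof -
  \<comment> \<open>\<open>I2\<close> and \<open>I4\<close> are antiderivatives of the second and
    fourth powers of sin (2t). \<open>K2\<close> and \<open>K4\<close> belong to the same powers
    times cos (2t); being periodic, they contribute nothing over a full turn.\<close>
  define I2 where "I2 t = t/2 - sin (2*t) * cos (2*t) / 4" for t :: real
  define I4 where "I4 t = 3/8*t - 3/16 * (sin (2*t) * cos (2*t)) - (sin (2*t))^3 * cos (2*t) / 8" for t :: real
  define K2 where "K2 t = (sin (2*t))^3 / 6" for t :: real
  define K4 where "K4 t = (sin (2*t))^5 / 10" for t :: real
  have C: "(cos (2*t))\<^sup>2 = 1 - (sin (2*t))\<^sup>2" for t :: real by (simp add: cos_squared_eq)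
  have I2: "(I2 has_real_derivative (sin (2*t))\<^sup>2) (at t within S)" for t S
  proof -
    have "(I2 has_real_derivative 1/2 - (2 * (cos (2*t))\<^sup>2 - 2 * (sin (2*t))\<^sup>2) / 4) (at t within S)"
      unfolding I2_def by (auto intro!: derivative_eq_intros simp: power2_eq_square)
    then show ?thesis by (rule DERIV_cong) (unfold C, simp add: field_simps)
  qed
  have I4: "(I4 has_real_derivative (sin (2*t))^4) (at t within S)" for t S
  proof -
    have "(I4 has_real_derivative 3/8 - 3/16 * (2 * (cos (2*t))\<^sup>2 - 2 * (sin (2*t))\<^sup>2)
            - (6 * (sin (2*t))\<^sup>2 * (cos (2*t))\<^sup>2 - 2 * (sin (2*t))^4) / 8) (at t within S)"
      unfolding I4_def
      by (auto intro!: derivative_eq_intros simp: power2_eq_square power3_eq_cube power4_eq_xxxx field_simps)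
    then show ?thesis
      by (rule DERIV_cong) (unfold C, simp add: field_simps power2_eq_square power4_eq_xxxx)
  qed
  have K2: "(K2 has_real_derivative (sin (2*t))\<^sup>2 * cos (2*t)) (at t within S)" for t S
    unfolding K2_def by (auto intro!: derivative_eq_intros)
  have K4: "(K4 has_real_derivative (sin (2*t))^4 * cos (2*t)) (at t within S)" for t S
    unfolding K4_def by (auto intro!: derivative_eq_intros)
  define G where "G t = (1 - a) * (6/7) / 4 * I2 t + (6/7) * (3/2 * a) * (3/56 * I2 t + 7/96 * I4 t) +
     (6/7) * ((1 - a) * (6/7)\<^sup>2 * (2/3)) * (3/56 * (I2 t + K2 t) + 7/96 * (I4 t + K4 t))" for t
  have "(G has_real_derivative rate_majorant a t) (at t within S)" for t S
  proof -
    have "(G has_real_derivative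
       (1 - a) * (6/7) / 4 * (sin (2*t))\<^sup>2 + (6/7) * (3/2 * a) * (3/56 * (sin (2*t))\<^sup>2 + 7/96 * (sin (2*t))^4) +
       (6/7) * ((1 - a) * (6/7)\<^sup>2 * (2/3)) * (3/56 * ((sin (2*t))\<^sup>2 + (sin (2*t))\<^sup>2 * cos (2*t)) + 7/96 * ((sin (2*t))^4 + (sin (2*t))^4 * cos (2*t)))) (at t within S)"
      unfolding G_def by (intro DERIV_add DERIV_cmult I2 I4 K2 K4)
    then show ?thesis by (rule DERIV_cong) (simp add: rate_majorant_def field_simps)
  qed
  then have "(rate_majorant a has_integral G (2*pi) - G 0) {0..2*pi}"
    by (intro fundamental_theorem_of_calculus) (auto simp flip: has_real_derivative_iff_has_vector_derivative)
  then have "integral {0..2*pi} (rate_majorant a) = G (2*pi) - G 0" by (rule integral_unique)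
  also have "\<dots> = (1 - a) * (6/7) / 4 * pi + (6/7) * (3/2 * a) * (3/56 * pi + 7/96 * (3/4 * pi)) +
     (6/7) * ((1 - a) * (6/7)\<^sup>2 * (2/3)) * (3/56 * pi + 7/96 * (3/4 * pi))"
  proof -
    have "sin (2 * (2 * pi)) = 0" using sin_int_2pin[of 2] by (simp add: algebra_simps)
    then show ?thesis by (simp add: G_def I2_def I4_def K2_def K4_def)
  qed
  also have "\<dots> = (1 - a) * (pi * (3/14 + 144/343 * (3/56 + 7/128))) + a * (pi * (9/7 * (3/56 + 7/128)))"
    by (simp add: field_simps power2_eq_square)
  also have "\<dots> \<le> (1 - a) * (5/6) + a * (1/2)"
    using assms pi_approx(2) by (intro add_mono mult_left_mono) auto
  finally show ?thesis by (simp add: field_simps)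
qed

section \<open>Uniform Lipschitz bounds for rational families\<close>

text \<open>Bounds are bundled with Lipschitz constants because products need both. The class is
  closed under the operations that build the rational right-hand sides, so no explicit constant has
  to be computed, and the constants are uniform in the parameter.\<close>

definition bounded_lipschitz :: "'p set \<Rightarrow> 'a::real_normed_vector set \<Rightarrow> ('p \<Rightarrow> 'a \<Rightarrow> 'b::real_normed_field) \<Rightarrow> bool" where
  "bounded_lipschitz P S f \<longleftrightarrow> (\<exists>M L. \<forall>p\<in>P. \<forall>x\<in>S. \<forall>y\<in>S.
      norm (f p x) \<le> M \<and> norm (f p x - f p y) \<le> L * norm (x - y))"

lemma bounded_lipschitz_const:
  assumes "\<And>p. p \<in> P \<Longrightarrow> norm (g p) \<le> M"
  shows "bounded_lipschitz P S (\<lambda>p x. g p)"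
  unfolding bounded_lipschitz_def by (rule exI[of _ M], rule exI[of _ 0]) (use assms in auto)

lemma bounded_lipschitz_ident:
  assumes "bounded S"
  shows "bounded_lipschitz P S (\<lambda>p x. x)"
proof -
  obtain B where "\<And>x. x \<in> S \<Longrightarrow> norm x \<le> B" using assms by (auto simp: bounded_iff)
  then show ?thesis
    unfolding bounded_lipschitz_def by (intro exI[of _ B] exI[of _ 1]) auto
qed

lemma bounded_lipschitz_add:
  assumes "bounded_lipschitz P S f" "bounded_lipschitz P S g"
  shows "bounded_lipschitz P S (\<lambda>p x. f p x + g p x)"
proof -
  obtain M L M' L' where *: "\<And>p x y. p \<in> P \<Longrightarrow> x \<in> S \<Longrightarrow> y \<in> S \<Longrightarrow>
      norm (f p x) \<le> M \<and> norm (f p x - f p y) \<le> L * norm (x - y) \<and>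
      norm (g p x) \<le> M' \<and> norm (g p x - g p y) \<le> L' * norm (x - y)"
    using assms unfolding bounded_lipschitz_def by blast
  have "norm (f p x + g p x) \<le> M + M' \<and>
      norm (f p x + g p x - (f p y + g p y)) \<le> (L + L') * norm (x - y)"
    if "p \<in> P" "x \<in> S" "y \<in> S" for p x y
    using *[OF that] norm_triangle_mono[of "f p x" M "g p x" M']
      norm_triangle_mono[of "f p x - f p y" "L * norm (x - y)" "g p x - g p y" "L' * norm (x - y)"]
    by (simp add: algebra_simps)
  then show ?thesis unfolding bounded_lipschitz_def by blast
qed

lemma bounded_lipschitz_mult:
  assumes "bounded_lipschitz P S f" "bounded_lipschitz P S g"
  shows "bounded_lipschitz P S (\<lambda>p x. f p x * g p x)"
proof -
  obtain M L M' L' where *: "\<And>p x y. p \<in> P \<Longrightarrow> x \<in> S \<Longrightarrow> y \<in> S \<Longrightarrow>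
      norm (f p x) \<le> M \<and> norm (f p x - f p y) \<le> L * norm (x - y) \<and>
      norm (g p x) \<le> M' \<and> norm (g p x - g p y) \<le> L' * norm (x - y)"
    using assms unfolding bounded_lipschitz_def by blast
  have "norm (f p x * g p x) \<le> M * M' \<and>
      norm (f p x * g p x - f p y * g p y) \<le> (M * L' + L * M') * norm (x - y)"
    if p: "p \<in> P" "x \<in> S" "y \<in> S" for p x y
  proof
    show "norm (f p x * g p x) \<le> M * M'"
      unfolding norm_mult using *[OF p] by (intro mult_mono) (auto intro: order_trans[OF norm_ge_zero])
    have "norm (f p x * (g p x - g p y)) \<le> M * (L' * norm (x - y))"
      unfolding norm_mult using *[OF p] by (intro mult_mono) (auto intro: order_trans[OF norm_ge_zero])
    moreover have "norm ((f p x - f p y) * g p y) \<le> (L * norm (x - y)) * M'"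
      unfolding norm_mult using *[OF p] *[OF p(1,3,2)]
      by (intro mult_mono) (auto intro: order_trans[OF norm_ge_zero])
    moreover have "f p x * g p x - f p y * g p y = f p x * (g p x - g p y) + (f p x - f p y) * g p y"
      by (simp add: algebra_simps)
    ultimately show "norm (f p x * g p x - f p y * g p y) \<le> (M * L' + L * M') * norm (x - y)"
      using norm_triangle_mono by (fastforce simp: algebra_simps)
  qed
  then show ?thesis unfolding bounded_lipschitz_def by blast
qed

lemma bounded_lipschitz_inverse:
  assumes "bounded_lipschitz P S f" and "\<delta> > 0"
    and ge: "\<And>p x. p \<in> P \<Longrightarrow> x \<in> S \<Longrightarrow> \<delta> \<le> norm (f p x)"
  shows "bounded_lipschitz P S (\<lambda>p x. inverse (f p x))"
proof -
  obtain M L where *: "\<And>p x y. p \<in> P \<Longrightarrow> x \<in> S \<Longrightarrow> y \<in> S \<Longrightarrow>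
      norm (f p x) \<le> M \<and> norm (f p x - f p y) \<le> L * norm (x - y)"
    using assms(1) unfolding bounded_lipschitz_def by blast
  have inv: "norm (inverse (f p x)) \<le> inverse \<delta>" "f p x \<noteq> 0" if "p \<in> P" "x \<in> S" for p x
    using ge[OF that] \<open>\<delta> > 0\<close> by (auto simp: norm_inverse intro: le_imp_inverse_le)
  have "norm (inverse (f p x)) \<le> inverse \<delta> \<and>
      norm (inverse (f p x) - inverse (f p y)) \<le> (inverse \<delta> * L * inverse \<delta>) * norm (x - y)"
    if p: "p \<in> P" "x \<in> S" "y \<in> S" for p x y
  proof
    have "inverse (f p x) - inverse (f p y) = - (inverse (f p x) * (f p x - f p y) * inverse (f p y))"
      using inv p by (intro inverse_diff_inverse)
    then have "norm (inverse (f p x) - inverse (f p y)) =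
        norm (inverse (f p x)) * norm (f p x - f p y) * norm (inverse (f p y))"
      by (simp add: norm_mult)
    also have "\<dots> \<le> inverse \<delta> * (L * norm (x - y)) * inverse \<delta>"
    proof -
      have "0 \<le> L * norm (x - y)" using *[OF p] norm_ge_zero order_trans by blast
      from mult_nonneg_nonneg[OF _ this, of "inverse \<delta>"]
      have "0 \<le> inverse \<delta> * (L * norm (x - y))" using \<open>\<delta> > 0\<close> by simp
      then show ?thesis using *[OF p] inv p \<open>\<delta> > 0\<close> by (intro mult_mono) auto
    qed
    finally show "norm (inverse (f p x) - inverse (f p y)) \<le> (inverse \<delta> * L * inverse \<delta>) * norm (x - y)"
      by (simp add: mult.assoc mult.left_commute mult.commute)
  qed (use inv p in auto)
  then show ?thesis unfolding bounded_lipschitz_def by blast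
qed

lemma bounded_lipschitz_power:
  "bounded_lipschitz P S f \<Longrightarrow> bounded_lipschitz P S (\<lambda>p x. f p x ^ n)"
  by (induction n) (auto intro: bounded_lipschitz_mult bounded_lipschitz_const[of _ _ 1])

lemma bounded_lipschitz_sum:
  "finite A \<Longrightarrow> (\<And>i. i \<in> A \<Longrightarrow> bounded_lipschitz P S (f i)) \<Longrightarrow>
    bounded_lipschitz P S (\<lambda>p x. \<Sum>i\<in>A. f i p x)"
  by (induction A rule: finite_induct)
     (auto intro: bounded_lipschitz_add bounded_lipschitz_const[of _ _ 0])

lemma bounded_lipschitzE:
  assumes "bounded_lipschitz P S f"
  obtains L where "L \<ge> 0" "\<And>p x y. p \<in> P \<Longrightarrow> x \<in> S \<Longrightarrow> y \<in> S \<Longrightarrow>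
    norm (f p x - f p y) \<le> L * norm (x - y)"
proof -
  obtain M L where *: "\<And>p x y. p \<in> P \<Longrightarrow> x \<in> S \<Longrightarrow> y \<in> S \<Longrightarrow>
      norm (f p x - f p y) \<le> L * norm (x - y)"
    using assms unfolding bounded_lipschitz_def by blast
  \<comment> \<open>The constant may be negative, for instance when \<open>S\<close> has at most one
    point; its absolute value also works.\<close>
  have "norm (f p x - f p y) \<le> \<bar>L\<bar> * norm (x - y)" if "p \<in> P" "x \<in> S" "y \<in> S" for p x y
    using *[OF that] by (rule order_trans) (simp add: mult_right_mono)
  then show ?thesis using that[of "\<bar>L\<bar>"] by auto
qed

section \<open>The complex backward flow\<close>

text \<open>1 - (1/2)(5/6) = 7/12 and (1/2)/(7/12) = 6/7. Thus the bound 5/6 on \<open>v\<close>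
  yields precisely the radius bound 6/7 under which the integral estimate returns 5/6 again.\<close>

lemma moebius_radius_bound:
  fixes z v :: complex
  assumes "norm z < 1/2" "norm v \<le> 5/6"
  shows "7/12 \<le> norm (1 + z * v)" "norm (z / (1 + z * v)) \<le> 6/7"
proof -
  have "norm (z * v) \<le> 1/2 * (5/6)"
    unfolding norm_mult using assms by (intro mult_mono) auto
  then show 1: "7/12 \<le> norm (1 + z * v)"
    using norm_triangle_ineq2[of 1 "- (z * v)"] by simp
  have "norm z / norm (1 + z * v) \<le> (1/2) / (7/12)"
    using assms 1 by (intro frac_le) auto
  then show "norm (z / (1 + z * v)) \<le> 6/7" by (simp add: norm_divide)
qed

lemma inv_radius_rate_denom:
  assumes "(\<Sum>i=1..d. \<bar>\<mu> i\<bar>) = 1" "d \<ge> 1" "norm r \<le> 6/7"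
  shows "2/3 \<le> norm (1 + of_real (sin t * (cos t)\<^sup>2) * r * lien_quot d \<mu> (r * of_real (cos t)))"
  using inv_radius_rate_bound(2)[OF assms, of t]
    norm_triangle_ineq2[of 1 "- (of_real (sin t * (cos t)\<^sup>2) * r * lien_quot d \<mu> (r * of_real (cos t)))"]
  by (simp del: of_real_mult)

text \<open>The linear coefficient is integrated exactly, giving \<open>\<mu>\<^sub>1 sin\<^sup>3 \<tau> / 3\<close>: bounding it by absolute
  values would cost \<open>4/3\<close> over a full turn and the estimate would fail.\<close>
lemma inv_radius_rate_integral_bound:
  assumes \<mu>: "(\<Sum>i=1..d. \<bar>\<mu> i\<bar>) = 1" "d \<ge> 1" and \<tau>: "\<tau> \<in> {0..2*pi}"
    and cont: "continuous_on {0..2*pi} (\<lambda>t. inv_radius_rate d \<mu> t (r t))"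
    and r: "\<And>t. t \<in> {0..2*pi} \<Longrightarrow> norm (r t) \<le> 6/7"
  shows "norm (integral {0..\<tau>} (\<lambda>t. inv_radius_rate d \<mu> t (r t))) \<le> 5/6"
proof -
  define a where "a = \<bar>\<mu> 1\<bar>"
  have a: "0 \<le> a" "a \<le> 1"
    using member_le_sum[of 1 "{1..d}" "\<lambda>i. \<bar>\<mu> i\<bar>"] \<mu> by (auto simp: a_def)
  define l where "l t = complex_of_real (\<mu> 1 * cos t * (sin t)\<^sup>2)" for t
  have l: "(l has_integral of_real (\<mu> 1 * (sin \<tau>)^3 / 3)) {0..\<tau>}"
  proof -
    have "((\<lambda>t. \<mu> 1 * cos t * (sin t)\<^sup>2) has_integral \<mu> 1 * (sin \<tau>)^3 / 3 - \<mu> 1 * (sin 0)^3 / 3) {0..\<tau>}"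
      using \<tau> by (intro fundamental_theorem_of_calculus)
        (auto simp flip: has_real_derivative_iff_has_vector_derivative intro!: derivative_eq_intros)
    from has_integral_linear[OF this bounded_linear_of_real[where 'a = complex]] show ?thesis
      by (simp add: o_def l_def[abs_def])
  qed
  have int: "(\<lambda>t. inv_radius_rate d \<mu> t (r t)) integrable_on {0..\<tau>}"
    using \<tau> by (auto intro!: integrable_continuous_real continuous_on_subset[OF cont])
  have maj: "(rate_majorant a) integrable_on {0..s}" for s
    unfolding rate_majorant_def[abs_def] by (auto intro!: integrable_continuous_real continuous_intros)
  have "norm (integral {0..\<tau>} (\<lambda>t. inv_radius_rate d \<mu> t (r t) + l t)) \<le> integral {0..\<tau>} (rate_majorant a)"
  proof (rule integral_norm_bound_integral[OF integrable_add[OF int has_integral_integrable[OF l]] maj])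
    show "norm (inv_radius_rate d \<mu> t (r t) + l t) \<le> rate_majorant a t" if "t \<in> {0..\<tau>}" for t
      unfolding l_def a_def using that \<tau> by (intro inv_radius_rate_bound(1)[OF \<mu> r]) auto
  qed
  \<comment> \<open>The majorant is nonnegative, so a partial turn costs at most as much as a full
    one.\<close>
  also have "\<dots> \<le> integral {0..2*pi} (rate_majorant a)"
    using maj \<tau> rate_majorant_nonneg[OF a] by (intro integral_subset_le) auto
  also have "\<dots> \<le> 5/6 - a/3" by (rule rate_majorant_integral[OF a])
  finally have 1: "norm (integral {0..\<tau>} (\<lambda>t. inv_radius_rate d \<mu> t (r t) + l t)) \<le> 5/6 - a/3" .
  have 2: "integral {0..\<tau>} (\<lambda>t. inv_radius_rate d \<mu> t (r t) + l t) =
      integral {0..\<tau>} (\<lambda>t. inv_radius_rate d \<mu> t (r t)) + of_real (\<mu> 1 * (sin \<tau>)^3 / 3)"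
    using int l by (metis integral_add integral_unique has_integral_integrable)
  \<comment> \<open>This consumes exactly the slack a/3 left by the majorant.\<close>
  have 3: "norm (complex_of_real (\<mu> 1 * (sin \<tau>)^3 / 3)) \<le> a / 3"
    unfolding norm_of_real
    by (simp add: a_def abs_mult power_abs mult_left_le power_le_one)
  show ?thesis
    using 1 3 norm_triangle_ineq4[of "integral {0..\<tau>} (\<lambda>t. inv_radius_rate d \<mu> t (r t)) + of_real (\<mu> 1 * (sin \<tau>)^3 / 3)" "of_real (\<mu> 1 * (sin \<tau>)^3 / 3)"]
    unfolding 2 by simp
qed

text \<open>Picard iteration with T = 2\<pi> and V = 5/6 for the rate evaluated at r = z/(1 + z v).
  Two denominators have to stay away from 0: that of r, by 7/12, and that of the rate, by
  2/3.\<close>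

theorem inv_radius_flow:
  assumes \<mu>: "(\<Sum>i=1..d. \<bar>\<mu> i\<bar>) = 1" "d \<ge> 1"
  obtains v where
    "\<And>z. z \<in> ball 0 (1/2) \<Longrightarrow> v z 0 = 0"
    "\<And>z \<tau>. z \<in> ball 0 (1/2) \<Longrightarrow> \<tau> \<in> {0..2*pi} \<Longrightarrow> norm (v z \<tau>) \<le> 5/6"
    "\<And>z \<tau>. z \<in> ball 0 (1/2) \<Longrightarrow> \<tau> \<in> {0..2*pi} \<Longrightarrow>
       (v z has_vector_derivative inv_radius_rate d \<mu> \<tau> (z / (1 + z * v z \<tau>))) (at \<tau> within {0..2*pi})"
    "\<And>\<tau>. \<tau> \<in> {0..2*pi} \<Longrightarrow> (\<lambda>z. v z \<tau>) holomorphic_on ball 0 (1/2)"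
    "\<And>z \<tau>. z \<in> ball 0 (1/2) \<Longrightarrow> \<tau> \<in> {0..2*pi} \<Longrightarrow> z \<in> \<real> \<Longrightarrow> v z \<tau> \<in> \<real>"
proof -
  note result = that
  define H where "H \<tau> z v = inv_radius_rate d \<mu> \<tau> (z / (1 + z * v))" for \<tau> z v
  have nz1: "1 + z * v \<noteq> 0" if "norm z < 1/2" "norm v \<le> 5/6" for z v :: complex
    using moebius_radius_bound[OF that] by auto
  have nz2: "1 + of_real (sin t * (cos t)\<^sup>2) * (z / (1 + z * v)) *
        lien_quot d \<mu> (z / (1 + z * v) * of_real (cos t)) \<noteq> 0"
    if "norm z < 1/2" "norm v \<le> 5/6" for t z v
    using inv_radius_rate_denom[OF \<mu> moebius_radius_bound(2)[OF that], of t] by auto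
  have cont: "continuous_on ({0..2*pi} \<times> ball 0 (1/2) \<times> cball 0 (5/6)) (\<lambda>(t, z, v). H t z v)"
    unfolding H_def inv_radius_rate_def case_prod_beta
    using nz1 nz2 by (intro continuous_intros) (auto simp: lien_quot_def intro!: continuous_intros)
  have hol: "(\<lambda>z. H t z (g z)) holomorphic_on ball 0 (1/2)"
    if "g holomorphic_on ball 0 (1/2)" "g ` ball 0 (1/2) \<subseteq> cball 0 (5/6)" for t g
  proof -
    have "norm (g z) \<le> 5/6" if "norm z < 1/2" for z
    proof -
      have "z \<in> ball 0 (1/2)" using that by simp
      then have "g z \<in> cball 0 (5/6)" using \<open>g ` _ \<subseteq> _\<close> by blast
      then show ?thesis by simp
    qed
    then show ?thesis
      unfolding H_def inv_radius_rate_def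
      using nz1 nz2 that(1) by (intro holomorphic_intros) (auto simp: lien_quot_def intro!: holomorphic_intros)
  qed
  have lip: "bounded_lipschitz (UNIV \<times> ball 0 (1/2)) (cball 0 (5/6)) (\<lambda>(t, z) v. H t z v)"
  proof -
    let ?L = "bounded_lipschitz (UNIV \<times> ball 0 (1/2)) (cball 0 (5/6)) ::
      (real \<times> complex \<Rightarrow> complex \<Rightarrow> complex) \<Rightarrow> bool"
    have z: "?L (\<lambda>p v. snd p)" by (rule bounded_lipschitz_const[of _ _ "1/2"]) auto
    have trig: "\<bar>(sin t) ^ m * (cos t) ^ n\<bar> \<le> 1" for t :: real and m n
      by (simp add: abs_mult power_abs mult_le_one power_le_one)
    have tr: "?L (\<lambda>p v. of_real ((sin (fst p)) ^ m * (cos (fst p)) ^ n))" for m n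
      by (rule bounded_lipschitz_const[of _ _ 1]) (use trig in \<open>simp del: of_real_mult of_real_power\<close>)
    have r: "?L (\<lambda>p v. snd p * inverse (1 + snd p * v))"
      using moebius_radius_bound(1)
      by (intro bounded_lipschitz_mult bounded_lipschitz_inverse[of _ _ _ "7/12"] bounded_lipschitz_add
           bounded_lipschitz_ident z bounded_lipschitz_const[of _ _ 1]) auto
    have q: "?L (\<lambda>p v. lien_quot d \<mu> (snd p * inverse (1 + snd p * v) * of_real (cos (fst p))))"
      unfolding lien_quot_def
      using tr[of 0 1] by (intro bounded_lipschitz_sum bounded_lipschitz_mult bounded_lipschitz_power r
           bounded_lipschitz_const[OF order_refl]) auto
    have "?L (\<lambda>p v. - of_real (cos (fst p) * (sin (fst p))\<^sup>2) * lien_quot d \<mu> (snd p * inverse (1 + snd p * v) * of_real (cos (fst p))) *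
        inverse (1 + of_real (sin (fst p) * (cos (fst p))\<^sup>2) * (snd p * inverse (1 + snd p * v)) *
           lien_quot d \<mu> (snd p * inverse (1 + snd p * v) * of_real (cos (fst p)))))"
    proof (intro q r bounded_lipschitz_mult bounded_lipschitz_inverse[of _ _ _ "2/3"] bounded_lipschitz_add)
      show "?L (\<lambda>p v. 1)" by (rule bounded_lipschitz_const[of _ _ 1]) auto
      show "?L (\<lambda>p v. of_real (sin (fst p) * (cos (fst p))\<^sup>2))" using tr[of 1 2] by simp
      show "?L (\<lambda>p v. - of_real (cos (fst p) * (sin (fst p))\<^sup>2))"
        by (rule bounded_lipschitz_const[of _ _ 1])
           (use trig[of _ 2 1] in \<open>simp add: mult.commute del: of_real_mult of_real_power\<close>)
      show "2/3 \<le> norm (1 + of_real (sin (fst p) * (cos (fst p))\<^sup>2) * (snd p * inverse (1 + snd p * v)) *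
           lien_quot d \<mu> (snd p * inverse (1 + snd p * v) * of_real (cos (fst p))))"
        if "p \<in> UNIV \<times> ball 0 (1/2)" "v \<in> cball 0 (5/6)" for p :: "real \<times> complex" and v
      proof -
        have "norm (snd p / (1 + snd p * v)) \<le> 6/7"
          using that by (intro moebius_radius_bound) (auto simp: mem_Times_iff)
        from inv_radius_rate_denom[OF \<mu> this, of "fst p"] show ?thesis unfolding divide_inverse .
      qed
    qed auto
    then show ?thesis unfolding H_def inv_radius_rate_def case_prod_beta divide_inverse .
  qed
  from bounded_lipschitzE[OF lip] obtain L where L: "L \<ge> 0" and
    "\<And>p v w. p \<in> UNIV \<times> ball 0 (1/2) \<Longrightarrow> v \<in> cball 0 (5/6) \<Longrightarrow> w \<in> cball 0 (5/6) \<Longrightarrow>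
       norm ((\<lambda>(t, z) v. H t z v) p v - (\<lambda>(t, z) v. H t z v) p w) \<le> L * norm (v - w)"
    by blast
  from this(2)[of "(t, z)" for t z] have lip: "norm (H t z v - H t z w) \<le> L * norm (v - w)"
    if "z \<in> ball 0 (1/2)" "v \<in> cball 0 (5/6)" "w \<in> cball 0 (5/6)" for t z v w
    using that by simp
  show thesis
  proof (rule picard_holomorphic_parameter[of "ball 0 (1/2)" "2*pi" "5/6" L H])
    show "norm (integral {0..\<tau>} (\<lambda>t. H t z (w t))) \<le> 5/6"
      if "z \<in> ball 0 (1/2)" "\<tau> \<in> {0..2*pi}" "continuous_on {0..2*pi} w" "w ` {0..2*pi} \<subseteq> cball 0 (5/6)"
      for z w \<tau>
      unfolding H_def
    proof (rule inv_radius_rate_integral_bound[OF \<mu> that(2)])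
      show "continuous_on {0..2*pi} (\<lambda>t. inv_radius_rate d \<mu> t (z / (1 + z * w t)))"
        unfolding H_def[symmetric]
        by (rule continuous_on_compose2[OF cont, where f = "\<lambda>t. (t, z, w t)", simplified])
           (use that in \<open>auto intro!: continuous_intros\<close>)
      show "norm (z / (1 + z * w t)) \<le> 6/7" if "t \<in> {0..2*pi}" for t
        using \<open>z \<in> _\<close> subsetD[OF \<open>w ` _ \<subseteq> _\<close> imageI[OF that]] by (intro moebius_radius_bound) auto
    qed
    show "H t z v \<in> \<real>" if "z \<in> \<real>" "v \<in> \<real>" for t z v
      unfolding H_def inv_radius_rate_def lien_quot_def using that by (auto intro!: Reals_divide Reals_mult Reals_add sum_in_Reals Reals_power)
    show thesis
      if "\<And>z. z \<in> ball 0 (1/2) \<Longrightarrow> v z 0 = 0"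
        "\<And>z \<tau>. z \<in> ball 0 (1/2) \<Longrightarrow> \<tau> \<in> {0..2*pi} \<Longrightarrow> norm (v z \<tau>) \<le> 5/6"
        "\<And>z \<tau>. z \<in> ball 0 (1/2) \<Longrightarrow> \<tau> \<in> {0..2*pi} \<Longrightarrow>
           (v z has_vector_derivative H \<tau> z (v z \<tau>)) (at \<tau> within {0..2*pi})"
        "\<And>\<tau>. \<tau> \<in> {0..2*pi} \<Longrightarrow> (\<lambda>z. v z \<tau>) holomorphic_on ball 0 (1/2)"
        "\<And>z \<tau>. z \<in> ball 0 (1/2) \<Longrightarrow> \<tau> \<in> {0..2*pi} \<Longrightarrow> z \<in> \<real> \<Longrightarrow> v z \<tau> \<in> \<real>"
      for v :: "complex \<Rightarrow> real \<Rightarrow> complex"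
      using that unfolding H_def by (rule result)
  qed (use cont lip hol L in auto)
qed

section \<open>Identification with the real return map\<close>

text \<open>The Lipschitz bound is required only in a tube around \<open>g\<close>, since nothing
  confines \<open>f\<close> in advance. Just after the last common point before \<open>t\<close>,
  continuity keeps \<open>f\<close> in the tube, and a Gronwall argument then produces a later
  common point, a contradiction.\<close>

lemma real_ode_unique:
  fixes f g :: "real \<Rightarrow> real"
  assumes f: "\<And>t. t \<in> {a..b} \<Longrightarrow> (f has_real_derivative F t (f t)) (at t within {a..b})"
    and g: "\<And>t. t \<in> {a..b} \<Longrightarrow> (g has_real_derivative F t (g t)) (at t within {a..b})"
    and init: "f a = g a" and \<delta>: "\<delta> > 0"
    and lip: "\<And>t y. t \<in> {a..b} \<Longrightarrow> \<bar>y - g t\<bar> \<le> \<delta> \<Longrightarrow> \<bar>F t y - F t (g t)\<bar> \<le> L * \<bar>y - g t\<bar>"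
    and t: "t \<in> {a..b}"
  shows "f t = g t"
proof (rule ccontr)
  assume ne: "f t \<noteq> g t"
  define h where "h s = f s - g s" for s
  have hd: "(h has_real_derivative F s (f s) - F s (g s)) (at s within {a..b})" if "s \<in> {a..b}" for s
    unfolding h_def using f g that by (intro DERIV_diff)
  have ch: "continuous_on {a..b} h"
    using hd by (meson DERIV_continuous continuous_on_eq_continuous_within)
  define Z where "Z = {s \<in> {a..t}. h s = 0}"
  have "continuous_on {a..t} h" using ch t by (auto elim: continuous_on_subset)
  then have "closed Z" unfolding Z_def by (intro continuous_closed_preimage_constant) auto
  moreover have "bounded Z" unfolding Z_def by (rule bounded_subset[of "{a..t}"]) auto
  moreover have "a \<in> Z" using init t by (auto simp: Z_def h_def)
  ultimately obtain s0 where s0: "s0 \<in> Z" "\<And>s. s \<in> Z \<Longrightarrow> s \<le> s0"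
    using compact_attains_sup[of Z] by (auto simp: compact_eq_bounded_closed)
  have s0t: "a \<le> s0" "s0 < t" "h s0 = 0"
    using s0(1) ne by (auto simp: Z_def h_def less_le)
  have "continuous (at s0 within {a..b}) h"
    using ch s0t t by (auto simp: continuous_on_eq_continuous_within)
  then obtain e where e: "e > 0" "\<And>s. s \<in> {a..b} \<Longrightarrow> \<bar>s - s0\<bar> < e \<Longrightarrow> \<bar>h s\<bar> < \<delta>"
    using \<delta> s0t(3) unfolding continuous_within_eps_delta by (fastforce simp: dist_real_def)
  define t2 where "t2 = min t (s0 + e/2)"
  have t2: "s0 < t2" "t2 \<le> t" "t2 < s0 + e" using s0t e(1) by (auto simp: t2_def)
  have small: "\<bar>h s\<bar> < \<delta>" if "s \<in> {s0..t2}" for s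
    using that t2 s0t t by (intro e(2)) auto
  \<comment> \<open>The exponential weight turns the differential inequality for the squared
    difference into monotonicity; squaring avoids differentiating an absolute value.\<close>
  define D where "D s = (h s)\<^sup>2 * exp (- (2 * L * s))" for s
  have "D t2 \<le> D s0"
  proof (rule DERIV_nonpos_imp_decreasing_open[where f = D and a = s0 and b = t2])
    show "s0 \<le> t2" using t2 by simp
    show "continuous_on {s0..t2} D"
      unfolding D_def using t2 s0t t
      by (intro continuous_intros continuous_on_subset[OF ch]) auto
    fix s assume s: "s0 < s" "s < t2"
    then have sab: "s \<in> {a<..<b}" using s0t t2 t by auto
    then have "at s within {a..b} = at s" by (intro at_within_Icc_at) auto
    then have hs: "(h has_real_derivative F s (f s) - F s (g s)) (at s)"
      using hd[of s] sab by auto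
    have "(D has_real_derivative
        (2 * h s * (F s (f s) - F s (g s)) - 2 * L * (h s)\<^sup>2) * exp (- (2 * L * s))) (at s)"
      unfolding D_def by (auto intro!: derivative_eq_intros hs simp: algebra_simps power2_eq_square)
    moreover have "(2 * h s * (F s (f s) - F s (g s)) - 2 * L * (h s)\<^sup>2) * exp (- (2 * L * s)) \<le> 0"
    proof (rule mult_nonpos_nonneg)
      have "\<bar>F s (f s) - F s (g s)\<bar> \<le> L * \<bar>h s\<bar>"
        using lip[of s "f s"] small[of s] s sab by (auto simp: h_def)
      then have "\<bar>h s\<bar> * \<bar>F s (f s) - F s (g s)\<bar> \<le> \<bar>h s\<bar> * (L * \<bar>h s\<bar>)" by (intro mult_left_mono) auto
      also have "\<dots> = L * (h s)\<^sup>2" by (simp add: power2_eq_square abs_mult_self_eq mult.left_commute)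
      finally show "2 * h s * (F s (f s) - F s (g s)) - 2 * L * (h s)\<^sup>2 \<le> 0"
        using abs_ge_self[of "h s * (F s (f s) - F s (g s))"] by (simp add: abs_mult)
    qed simp
    ultimately show "\<exists>y. (D has_real_derivative y) (at s) \<and> y \<le> 0" by blast
  qed
  then have "(h t2)\<^sup>2 * exp (- (2 * L * t2)) \<le> 0" using s0t by (simp add: D_def)
  then have "h t2 = 0"
    by (metis exp_gt_zero linorder_not_less mult_pos_pos zero_less_power2)
  then have "t2 \<in> Z" using t2 s0t by (auto simp: Z_def)
  then show False using s0(2) t2 by force
qed

text \<open>For radii up to \<rho> the normalisation gives |p| \<le> 1, and |sin cos| \<le> 1/2, so
  the denominator has absolute value at least 1/2.\<close>

lemma polar_rhs_lipschitz:
  assumes \<rho>: "\<rho> > 0" and sum1: "(\<Sum>i=1..d. \<rho> ^ i * \<bar>lam i\<bar>) = 1"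
  obtains L where "\<And>t x y. \<bar>x\<bar> \<le> \<rho> \<Longrightarrow> \<bar>y\<bar> \<le> \<rho> \<Longrightarrow>
    \<bar>polar_rhs d lam t x - polar_rhs d lam t y\<bar> \<le> L * \<bar>x - y\<bar>"
proof -
  let ?L = "bounded_lipschitz UNIV {-\<rho>..\<rho>} :: (real \<Rightarrow> real \<Rightarrow> real) \<Rightarrow> bool"
  have cos: "?L (\<lambda>t x. cos t)" by (rule bounded_lipschitz_const[of _ _ 1]) auto
  have sin: "?L (\<lambda>t x. sin t)" by (rule bounded_lipschitz_const[of _ _ 1]) auto
  have id: "?L (\<lambda>t x. x)" by (rule bounded_lipschitz_ident) auto
  have p: "?L (\<lambda>t x. lien_p d lam (x * cos t))"
    unfolding lien_p_def
    by (intro bounded_lipschitz_sum bounded_lipschitz_mult bounded_lipschitz_power cos id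
          bounded_lipschitz_const[OF order_refl]) auto
  have p1: "\<bar>lien_p d lam (x * cos t)\<bar> \<le> 1" if "x \<in> {-\<rho>..\<rho>}" for x t
  proof -
    have "\<bar>x * cos t\<bar> \<le> \<rho> * 1"
      unfolding abs_mult using that \<rho> by (intro mult_mono) auto
    then have "\<bar>lam i * (x * cos t) ^ i\<bar> \<le> \<rho> ^ i * \<bar>lam i\<bar>" for i
      unfolding abs_mult[of "lam i"] power_abs
      by (subst mult.commute) (intro mult_right_mono power_mono, auto)
    then show ?thesis
      unfolding lien_p_def sum1[symmetric] by (intro order_trans[OF sum_abs] sum_mono)
  qed
  have den: "1/2 \<le> norm (-1 + sin t * cos t * lien_p d lam (x * cos t))" if "x \<in> {-\<rho>..\<rho>}" for t x
  proof -
    have "\<bar>sin t * cos t\<bar> \<le> 1/2"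
      using abs_sin_le_one[of "2*t"] by (simp add: sin_double abs_mult)
    then have "\<bar>sin t * cos t * lien_p d lam (x * cos t)\<bar> \<le> 1/2 * 1"
      unfolding abs_mult[of "sin t * cos t"] using p1[OF that] by (intro mult_mono) auto
    then show ?thesis by simp
  qed
  have "?L (\<lambda>t x. x * lien_p d lam (x * cos t) * (sin t)\<^sup>2 *
      inverse (-1 + sin t * cos t * lien_p d lam (x * cos t)))"
    using den by (intro bounded_lipschitz_inverse[of _ _ _ "1/2"] bounded_lipschitz_mult bounded_lipschitz_power bounded_lipschitz_add
        cos sin id p bounded_lipschitz_const[OF order_refl]) auto
  then have "?L (polar_rhs d lam)"
    unfolding polar_rhs_def[abs_def] divide_inverse .
  from bounded_lipschitzE[OF this] show ?thesis
    using that by (metis UNIV_I abs_le_iff atLeastAtMost_iff minus_le_iff real_norm_def)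
qed

lemma lien_p_of_real:
  "complex_of_real (lien_p d lam x) = of_real x * lien_quot d lam (of_real x)"
proof -
  have "complex_of_real (lam i) * of_real x ^ i = of_real x * (of_real (lam i) * of_real x ^ (i - 1))"
    if "i \<in> {1..d}" for i
    using that by (cases i) auto
  then have "(\<Sum>i=1..d. complex_of_real (lam i) * of_real x ^ i) =
      (\<Sum>i=1..d. of_real x * (of_real (lam i) * of_real x ^ (i - 1)))"
    by (rule sum.cong[OF refl])
  then show ?thesis unfolding lien_p_def lien_quot_def sum_distrib_left by simp
qed

text \<open>\<open>F\<close> sends the radius at 2\<pi> to the radius at 0. The two sign properties
  serve the intermediate value theorem: they show that the real restriction covers a neighbourhood
  of 0.\<close>

theorem polar_sol_inverse_germ:
  assumes d: "d \<ge> 1" and \<rho>: "\<rho> > 0" and sum1: "(\<Sum>i=1..d. \<rho> ^ i * \<bar>lam i\<bar>) = 1"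
  obtains F where "F holomorphic_on ball 0 (\<rho>/2)"
    "\<And>x. \<bar>x\<bar> < \<rho>/2 \<Longrightarrow> polar_sol d lam (2*pi) (Re (F (of_real x))) = x"
    "\<And>x. \<bar>x\<bar> < \<rho>/2 \<Longrightarrow> x > 0 \<Longrightarrow> Re (F (of_real x)) > 0"
    "\<And>x. \<bar>x\<bar> < \<rho>/2 \<Longrightarrow> x < 0 \<Longrightarrow> Re (F (of_real x)) < 0"
    "F 0 = 0"
proof -
  \<comment> \<open>Measuring radii in units of \<rho> replaces the coefficients by these, whose
    absolute values sum to 1.\<close>
  define \<mu> where "\<mu> i = \<rho> ^ i * lam i" for i
  have \<mu>: "(\<Sum>i=1..d. \<bar>\<mu> i\<bar>) = 1" using sum1 \<rho> by (simp add: \<mu>_def abs_mult)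
  obtain v where v0: "\<And>z. z \<in> ball 0 (1/2) \<Longrightarrow> v z 0 = 0"
    and vb: "\<And>z \<tau>. z \<in> ball 0 (1/2) \<Longrightarrow> \<tau> \<in> {0..2*pi} \<Longrightarrow> norm (v z \<tau>) \<le> 5/6"
    and vd: "\<And>z \<tau>. z \<in> ball 0 (1/2) \<Longrightarrow> \<tau> \<in> {0..2*pi} \<Longrightarrow>
       (v z has_vector_derivative inv_radius_rate d \<mu> \<tau> (z / (1 + z * v z \<tau>))) (at \<tau> within {0..2*pi})"
    and vh: "\<And>\<tau>. \<tau> \<in> {0..2*pi} \<Longrightarrow> (\<lambda>z. v z \<tau>) holomorphic_on ball 0 (1/2)"
    and vr: "\<And>z \<tau>. z \<in> ball 0 (1/2) \<Longrightarrow> \<tau> \<in> {0..2*pi} \<Longrightarrow> z \<in> \<real> \<Longrightarrow> v z \<tau> \<in> \<real>"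
    using inv_radius_flow[OF \<mu> d] by blast
  define F where "F z = z / (1 + z / of_real \<rho> * v (z / of_real \<rho>) (2*pi))" for z
  define u where "u x \<tau> = Re (v (of_real (x / \<rho>)) \<tau>)" for x \<tau>
  \<comment> \<open>The orbit in the original scale, \<rho> z/(1 + z v) at z = x/\<rho>, after the
    angle has run back by \<tau> from 2\<pi>. Nothing is divided by x, so x = 0 is covered.\<close>
  define f where "f x \<tau> = x / (1 + x / \<rho> * u x \<tau>)" for x \<tau>
  have ball: "complex_of_real (x / \<rho>) \<in> ball 0 (1/2)" if "\<bar>x\<bar> < \<rho>/2" for x
    using that \<rho> by (simp add: norm_divide field_simps)
  have u: "v (of_real (x / \<rho>)) \<tau> = of_real (u x \<tau>)" if "\<bar>x\<bar> < \<rho>/2" "\<tau> \<in> {0..2*pi}" for x \<tau>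
    using vr[OF ball[OF that(1)] that(2)] unfolding u_def by (metis Reals_of_real of_real_Re)
  have fb: "7/12 \<le> 1 + x / \<rho> * u x \<tau>" "\<bar>f x \<tau>\<bar> \<le> 6/7 * \<rho>" if "\<bar>x\<bar> < \<rho>/2" "\<tau> \<in> {0..2*pi}" for x \<tau>
  proof -
    have x: "\<bar>x / \<rho>\<bar> \<le> 1/2" using that \<rho> by (simp add: field_simps)
    have "\<bar>u x \<tau>\<bar> \<le> 5/6" using vb[OF ball[OF that(1)] that(2)] unfolding u[OF that] by simp
    with x have "\<bar>x / \<rho> * u x \<tau>\<bar> \<le> 1/2 * (5/6)"
      unfolding abs_mult by (intro mult_mono) auto
    then show 1: "7/12 \<le> 1 + x / \<rho> * u x \<tau>" by linarith
    then have "7/12 \<le> \<bar>1 + x / \<rho> * u x \<tau>\<bar>" by linarith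
    then have "\<bar>f x \<tau>\<bar> \<le> (\<rho>/2) / (7/12)"
      unfolding f_def abs_divide[of x] using that(1) \<rho> by (intro frac_le) linarith+
    then show "\<bar>f x \<tau>\<bar> \<le> 6/7 * \<rho>" by simp
  qed
  have fd: "(f x has_real_derivative - polar_rhs d lam (2*pi - \<tau>) (f x \<tau>)) (at \<tau> within {0..2*pi})"
    if x: "\<bar>x\<bar> < \<rho>/2" and \<tau>: "\<tau> \<in> {0..2*pi}" for x \<tau>
  proof -
    define r where "r = f x \<tau> / \<rho>"
    define p where "p = lien_p d lam (f x \<tau> * cos \<tau>)"
    define den where "den = 1 + x / \<rho> * u x \<tau>"
    have den: "den \<noteq> 0" using fb(1)[OF x \<tau>] unfolding den_def by linarith
    have fx: "f x \<tau> = x / den" by (simp add: f_def den_def)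
    have arg: "of_real (x / \<rho>) / (1 + of_real (x / \<rho>) * v (of_real (x / \<rho>)) \<tau>) = complex_of_real r"
      unfolding u[OF x \<tau>] r_def f_def by simp
    have lq: "of_real (f x \<tau> * cos \<tau>) * lien_quot d lam (of_real (f x \<tau> * cos \<tau>)) = complex_of_real p"
      unfolding p_def by (rule lien_p_of_real[symmetric])
    \<comment> \<open>\<rho>^i (y/\<rho>)^(i-1) leaves a single factor \<rho>, which later cancels
      against the one in f/\<rho>.\<close>
    have scale: "lien_quot d \<mu> (of_real r * of_real (cos \<tau>)) = of_real \<rho> * lien_quot d lam (of_real (f x \<tau> * cos \<tau>))"
    proof -
      have "complex_of_real (\<mu> i) * (of_real r * of_real (cos \<tau>)) ^ (i - 1) =
          of_real \<rho> * (of_real (lam i) * of_real (f x \<tau> * cos \<tau>) ^ (i - 1))" if "i \<in> {1..d}" for i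
        using that \<rho> by (cases i) (auto simp: \<mu>_def r_def power_mult_distrib power_divide)
      then show ?thesis unfolding lien_quot_def sum_distrib_left by (rule sum.cong[OF refl])
    qed
    have rate: "of_real (f x \<tau> / \<rho>) * inv_radius_rate d \<mu> \<tau> (of_real r) =
        of_real (- (p * (sin \<tau>)\<^sup>2 / (1 + sin \<tau> * cos \<tau> * p)))"
    proof -
      define Q where "Q = lien_quot d lam (of_real (f x \<tau> * cos \<tau>))"
      have "of_real (f x \<tau> / \<rho>) * inv_radius_rate d \<mu> \<tau> (of_real r) =
         - (of_real ((sin \<tau>)\<^sup>2) * (of_real (f x \<tau> * cos \<tau>) * Q)) /
           (1 + of_real (sin \<tau> * cos \<tau>) * (of_real (f x \<tau> * cos \<tau>) * Q))"
        unfolding inv_radius_rate_def scale Q_def[symmetric] using \<rho>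
        by (simp add: r_def power2_eq_square mult_ac)
      then show ?thesis unfolding Q_def lq by simp
    qed
    have "((\<lambda>t. Re (v (of_real (x / \<rho>)) t)) has_real_derivative
        Re (inv_radius_rate d \<mu> \<tau> (of_real r))) (at \<tau> within {0..2*pi})"
      using bounded_linear.has_vector_derivative[OF bounded_linear_Re vd[OF ball[OF x] \<tau>]]
      unfolding arg has_real_derivative_iff_has_vector_derivative .
    then have ud: "(u x has_real_derivative Re (inv_radius_rate d \<mu> \<tau> (of_real r))) (at \<tau> within {0..2*pi})"
      by (simp add: u_def[abs_def])
    \<comment> \<open>Formally 1/f = 1/x + u/\<rho>, whence f' = - f^2 u'/\<rho>; the quotient rule
      gives the same for x = 0.\<close>
    have "(f x has_real_derivative - (f x \<tau> * (f x \<tau> / \<rho> * Re (inv_radius_rate d \<mu> \<tau> (of_real r))))) (at \<tau> within {0..2*pi})"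
    proof -
      have "((\<lambda>t. 1 + x / \<rho> * u x t) has_real_derivative x / \<rho> * Re (inv_radius_rate d \<mu> \<tau> (of_real r))) (at \<tau> within {0..2*pi})"
        using DERIV_add[OF DERIV_const[of 1] DERIV_cmult[OF ud, of "x / \<rho>"]] by simp
      from DERIV_divide[OF DERIV_const[of x] this den[unfolded den_def]]
      have "(f x has_real_derivative (0 * den - x * (x / \<rho> * Re (inv_radius_rate d \<mu> \<tau> (of_real r)))) / (den * den)) (at \<tau> within {0..2*pi})"
        unfolding f_def[abs_def] den_def .
      then show ?thesis by (rule DERIV_cong) (simp add: fx)
    qed
    moreover have "f x \<tau> / \<rho> * Re (inv_radius_rate d \<mu> \<tau> (of_real r)) = - (p * (sin \<tau>)\<^sup>2 / (1 + sin \<tau> * cos \<tau> * p))"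
      using arg_cong[OF rate, of Re] by (simp only: Re_complex_of_real Im_complex_of_real times_complex.simps mult_zero_left diff_zero)
    ultimately have "(f x has_real_derivative f x \<tau> * (p * (sin \<tau>)\<^sup>2 / (1 + sin \<tau> * cos \<tau> * p))) (at \<tau> within {0..2*pi})"
      by (simp only: mult_minus_right minus_minus)
    moreover have "- polar_rhs d lam (2*pi - \<tau>) (f x \<tau>) = f x \<tau> * (p * (sin \<tau>)\<^sup>2 / (1 + sin \<tau> * cos \<tau> * p))"
    proof -
      have "sin (2*pi - \<tau>) = - sin \<tau>" "cos (2*pi - \<tau>) = cos \<tau>" by (simp_all add: sin_diff cos_diff)
      then show ?thesis
        unfolding polar_rhs_def p_def[symmetric]
        by (simp add: p_def[symmetric] minus_divide_right mult.assoc add.commute)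
    qed
    ultimately show ?thesis by simp
  qed
  have ReF: "Re (F (of_real x)) = f x (2*pi)" if "\<bar>x\<bar> < \<rho>/2" for x
  proof -
    have "F (of_real x) = of_real (f x (2*pi))"
      unfolding F_def f_def using u[OF that, of "2*pi"] by simp
    then show ?thesis by simp
  qed
  \<comment> \<open>Reversing the angle gives a genuine forward solution, which starts at
    \<open>f x (2*pi)\<close> and ends at \<open>x\<close>.\<close>
  have sol: "is_polar_sol d lam (2*pi) (f x (2*pi)) (\<lambda>t. f x (2*pi - t))" if x: "\<bar>x\<bar> < \<rho>/2" for x
    unfolding is_polar_sol_def
  proof (intro conjI ballI)
    fix t assume "t \<in> {min 0 (2*pi)..max 0 (2*pi)}"
    then have t: "t \<in> {0..2*pi}" by auto
    have im: "(\<lambda>s. 2*pi - s) ` {0..2*pi} = {0..2*pi}" by (simp add: image_diff_atLeastAtMost)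
    have "(f x has_real_derivative - polar_rhs d lam t (f x (2*pi - t))) (at (2*pi - t) within (\<lambda>s. 2*pi - s) ` {0..2*pi})"
      using fd[OF x, of "2*pi - t"] t unfolding im by simp
    then have "((\<lambda>s. f x (2*pi - s)) has_real_derivative - polar_rhs d lam t (f x (2*pi - t)) * (- 1)) (at t within {0..2*pi})"
      by (rule DERIV_image_chain[unfolded o_def]) (auto intro!: derivative_eq_intros)
    then show "((\<lambda>t. f x (2*pi - t)) has_real_derivative polar_rhs d lam t (f x (2*pi - t)))
        (at t within {min 0 (2*pi)..max 0 (2*pi)})" by simp
  qed simp
  obtain L where L: "\<And>t x y. \<bar>x\<bar> \<le> \<rho> \<Longrightarrow> \<bar>y\<bar> \<le> \<rho> \<Longrightarrow>
    \<bar>polar_rhs d lam t x - polar_rhs d lam t y\<bar> \<le> L * \<bar>x - y\<bar>"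
    using polar_rhs_lipschitz[OF \<rho> sum1] by blast
  have f0: "f x 0 = x" if "\<bar>x\<bar> < \<rho>/2" for x
    using v0[OF ball[OF that]] by (simp add: f_def u_def)
  have ps: "polar_sol d lam (2*pi) (f x (2*pi)) = x" if x: "\<bar>x\<bar> < \<rho>/2" for x
  proof -
    \<comment> \<open>\<open>polar_sol\<close> evaluates an unspecified solution; \<open>sol\<close>
      shows that one exists, and uniqueness determines its endpoint.\<close>
    define g where "g = (SOME g. is_polar_sol d lam (2*pi) (f x (2*pi)) g)"
    have g: "is_polar_sol d lam (2*pi) (f x (2*pi)) g"
      unfolding g_def by (rule someI[of "is_polar_sol d lam (2*pi) (f x (2*pi))", OF sol[OF x]])
    have "g (2*pi) = (\<lambda>t. f x (2*pi - t)) (2*pi)"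
    \<comment> \<open>The reference orbit stays within 6\<rho>/7, so a tube of width \<rho>/7 stays
      where the Lipschitz bound holds.\<close>
    proof (rule real_ode_unique[where f = g and g = "\<lambda>t. f x (2*pi - t)" and F = "polar_rhs d lam" and a = 0 and b = "2*pi" and \<delta> = "\<rho>/7" and L = L])
      fix t y assume t: "t \<in> {0..2*pi}" and y: "\<bar>y - f x (2*pi - t)\<bar> \<le> \<rho>/7"
      have "\<bar>f x (2*pi - t)\<bar> \<le> 6/7 * \<rho>" using t by (intro fb(2)[OF x]) auto
      then show "\<bar>polar_rhs d lam t y - polar_rhs d lam t (f x (2*pi - t))\<bar> \<le> L * \<bar>y - f x (2*pi - t)\<bar>"
        using y \<rho> by (intro L) linarith+
    qed (use g sol[OF x] \<rho> in \<open>auto simp: is_polar_sol_def\<close>)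
    then show ?thesis unfolding polar_sol_def g_def[symmetric] using f0[OF x] by simp
  qed
  have end_mem: "2*pi \<in> {0..2*pi}" by simp
  have "F holomorphic_on ball 0 (\<rho>/2)"
  proof -
    have sc: "(\<lambda>z. z / of_real \<rho>) ` ball 0 (\<rho>/2) \<subseteq> ball (0 :: complex) (1/2)"
      using \<rho> by (auto simp: dist_norm norm_divide field_simps)
    have "((\<lambda>z. v z (2*pi)) \<circ> (\<lambda>z. z / of_real \<rho>)) holomorphic_on ball 0 (\<rho>/2)"
      using \<rho> by (intro holomorphic_on_compose_gen[OF _ vh sc] holomorphic_intros) auto
    then have "(\<lambda>z. v (z / of_real \<rho>) (2*pi)) holomorphic_on ball 0 (\<rho>/2)" by (simp add: o_def)
    moreover have "1 + z / of_real \<rho> * v (z / of_real \<rho>) (2*pi) \<noteq> 0" if "z \<in> ball 0 (\<rho>/2)" for z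
    proof -
      have "z / of_real \<rho> \<in> ball 0 (1/2)" using sc that by blast
      then show ?thesis using moebius_radius_bound(1)[of "z / of_real \<rho>"] vb[of "z / of_real \<rho>" "2*pi"] by fastforce
    qed
    ultimately show ?thesis unfolding F_def using \<rho> by (intro holomorphic_intros) auto
  qed
  moreover have "f x (2*pi) > 0" if "\<bar>x\<bar> < \<rho>/2" "x > 0" for x
    unfolding f_def
  proof (rule divide_pos_pos)
    show "0 < 1 + x / \<rho> * u x (2*pi)" using fb(1)[OF that(1) end_mem] by linarith
  qed (use that in auto)
  moreover have "f x (2*pi) < 0" if "\<bar>x\<bar> < \<rho>/2" "x < 0" for x
    unfolding f_def
  proof (rule divide_neg_pos)
    show "0 < 1 + x / \<rho> * u x (2*pi)" using fb(1)[OF that(1) end_mem] by linarith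
  qed (use that in auto)
  ultimately show thesis using ReF ps by (intro that[of F]) (auto simp: F_def)
qed

section \<open>Taylor coefficients of the germ and convergence of the series\<close>

lemma higher_deriv_Re_of_real:
  assumes F: "F holomorphic_on ball 0 R" and x: "\<bar>x\<bar> < R"
  shows "(deriv ^^ k) (\<lambda>x. Re (F (of_real x))) x = Re ((deriv ^^ k) F (of_real x))"
  using x
proof (induction k arbitrary: x)
  case (Suc k)
  \<comment> \<open>Differentiating once more uses the induction hypothesis on a neighbourhood of
    \<open>x\<close>, hence the induction over arbitrary \<open>x\<close>.\<close>
  have "eventually (\<lambda>y. y \<in> {-R<..<R}) (nhds x)"
    using Suc.prems by (intro eventually_nhds_in_open) auto
  then have "eventually (\<lambda>y. (deriv ^^ k) (\<lambda>x. Re (F (of_real x))) y = Re ((deriv ^^ k) F (of_real y))) (nhds x)"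
    by eventually_elim (rule Suc.IH, auto)
  then have "(deriv ^^ Suc k) (\<lambda>x. Re (F (of_real x))) x = deriv (\<lambda>y. Re ((deriv ^^ k) F (of_real y))) x"
    by (simp add: deriv_cong_ev)
  also have "\<dots> = Re ((deriv ^^ Suc k) F (of_real x))"
  proof (rule DERIV_imp_deriv)
    have "(deriv ^^ k) F holomorphic_on ball 0 R" by (intro holomorphic_higher_deriv F) auto
    then have "((deriv ^^ k) F has_field_derivative deriv ((deriv ^^ k) F) (of_real x)) (at (of_real x))"
      using Suc.prems by (intro holomorphic_derivI[of _ "ball 0 R"]) auto
    then show "((\<lambda>y. Re ((deriv ^^ k) F (of_real y))) has_real_derivative Re ((deriv ^^ Suc k) F (of_real x))) (at x)"
      using has_field_derivative_Re[OF field_vector_diff_chain_at] by (auto intro!: derivative_eq_intros has_vector_derivative_real_field)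
  qed
  finally show ?case .
qed simp


theorem mainTheorem7:
  fixes d :: nat and lam :: "nat \<Rightarrow> real" and \<rho> :: real
  assumes "d \<ge> 1"
    and "\<exists>i\<in>{1..d}. lam i \<noteq> 0"
    and "\<rho> > 0"
    and "(\<Sum>i=1..d. \<rho> ^ i * \<bar>lam i\<bar>) = 1"
  shows "\<forall>z::complex. norm z < \<rho> / 2 \<longrightarrow>
           summable (\<lambda>k. complex_of_real (vcoeff d lam (k + 2) (2 * pi)) * z ^ (k + 2))"
proof (intro allI impI)
  fix z :: complex assume z: "norm z < \<rho>/2"
  obtain F where F: "F holomorphic_on ball 0 (\<rho>/2)"
    and F_sol: "\<And>x. \<bar>x\<bar> < \<rho>/2 \<Longrightarrow> polar_sol d lam (2*pi) (Re (F (of_real x))) = x"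
    and F_pos: "\<And>x. \<bar>x\<bar> < \<rho>/2 \<Longrightarrow> x > 0 \<Longrightarrow> Re (F (of_real x)) > 0"
    and F_neg: "\<And>x. \<bar>x\<bar> < \<rho>/2 \<Longrightarrow> x < 0 \<Longrightarrow> Re (F (of_real x)) < 0"
    and F0: "F 0 = 0"
    using polar_sol_inverse_germ[OF assms(1,3,4)] by blast
  define G where "G x = Re (F (of_real x))" for x
  have contG: "continuous_on {-\<rho>/2<..<\<rho>/2} G"
    unfolding G_def
    by (intro continuous_intros continuous_on_compose2[OF holomorphic_on_imp_continuous_on[OF F]]) auto
  have near0: "\<forall>\<^sub>F r in nhds 0. \<bar>r\<bar> < \<rho>/2"
    using eventually_nhds_in_open[of "{-\<rho>/2<..<\<rho>/2}" 0] assms(3) by (auto elim!: eventually_mono)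
  \<comment> \<open>The predicate behind the choice in \<open>polar_sol_inv\<close>. Since
    \<open>G\<close> satisfies it, so does the chosen function.\<close>
  define inv where "inv g \<longleftrightarrow> g 0 = 0 \<and> isCont g 0 \<and>
       (\<forall>\<^sub>F r in nhds 0. polar_sol d lam (2*pi) (g r) = r)" for g
  have "isCont G 0"
    using contG assms(3) by (auto simp: continuous_on_eq_continuous_at)
  then have "inv G"
    unfolding inv_def using near0 F0 F_sol by (auto simp: G_def elim!: eventually_mono)
  then have inv: "inv (polar_sol_inv d lam (2*pi))"
    using someI[of inv G] by (simp add: polar_sol_inv_def inv_def[abs_def])
  have "\<forall>\<^sub>F r in nhds 0. polar_sol_inv d lam (2*pi) r = G r"
  proof -
    define g where "g = polar_sol_inv d lam (2*pi)"
    \<comment> \<open>By the intermediate value theorem \<open>G\<close> attains every value in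
      (-\<eta>, \<eta>). Near 0 the chosen inverse therefore has the form g r = G x; following the
      orbit to 2\<pi> turns this into r = x, so g and \<open>G\<close> have the same germ.\<close>
    define \<eta> where "\<eta> = min (G (\<rho>/4)) (- G (-\<rho>/4))"
    have \<eta>: "\<eta> > 0" using F_pos[of "\<rho>/4"] F_neg[of "-\<rho>/4"] assms(3) by (auto simp: \<eta>_def G_def)
    have surj: "\<exists>x. \<bar>x\<bar> < \<rho>/2 \<and> G x = y" if "\<bar>y\<bar> < \<eta>" for y
    proof -
      have "\<exists>x\<ge>-\<rho>/4. x \<le> \<rho>/4 \<and> G x = y"
        using that assms(3) by (intro IVT' continuous_on_subset[OF contG]) (auto simp: \<eta>_def)
      then obtain x where "-\<rho>/4 \<le> x" "x \<le> \<rho>/4" "G x = y" by blast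
      then show ?thesis using assms(3) by (intro exI[of _ x]) auto
    qed
    have "(g \<longlongrightarrow> 0) (nhds 0)"
      using inv by (auto simp: inv_def g_def isCont_def tendsto_at_iff_tendsto_nhds)
    then have "\<forall>\<^sub>F r in nhds 0. \<bar>g r\<bar> < \<eta>"
      using \<eta> order_tendstoD(2)[OF tendsto_rabs, of g 0 "nhds 0" \<eta>] by simp
    moreover have "\<forall>\<^sub>F r in nhds 0. polar_sol d lam (2*pi) (g r) = r"
      using inv by (simp add: inv_def g_def)
    ultimately have "\<forall>\<^sub>F r in nhds 0. g r = G r"
    proof eventually_elim
      case (elim r)
      obtain x where x: "\<bar>x\<bar> < \<rho>/2" "G x = g r" using surj[OF elim(1)] by blast
      then have "x = r" using F_sol[OF x(1)] elim(2) by (simp add: G_def)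
      then show ?case using x by simp
    qed
    then show ?thesis by (simp add: g_def)
  qed
  then have coeff: "vcoeff d lam k (2*pi) = Re ((deriv ^^ k) F 0) / fact k" for k
    unfolding vcoeff_def G_def[abs_def]
    using higher_deriv_cong_ev[of "polar_sol_inv d lam (2*pi)" "\<lambda>x. Re (F (of_real x))" 0 0 k]
      higher_deriv_Re_of_real[OF F, of 0 k] assms(3) by simp
  \<comment> \<open>Convergence at the larger real point \<open>s\<close> gives absolute convergence
    at \<open>z\<close>.\<close>
  obtain s where s: "norm z < s" "s < \<rho>/2" using z dense by blast
  have "summable (\<lambda>k. (deriv ^^ k) F 0 / fact k * of_real s ^ k)"
    using holomorphic_power_series[OF F, of "of_real s"] s norm_ge_zero[of z]
    by (auto intro: sums_summable simp del: norm_ge_zero)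
  then have "summable (\<lambda>k. norm ((deriv ^^ k) F 0 / fact k * z ^ k))"
    using powser_insidea[of "\<lambda>k. (deriv ^^ k) F 0 / fact k" "of_real s" z] s norm_ge_zero[of z]
    by (simp del: norm_ge_zero)
  then have "summable (\<lambda>k. complex_of_real (vcoeff d lam k (2*pi)) * z ^ k)"
  proof (rule summable_comparison_test'[where N = 0])
    fix k
    \<comment> \<open>The coefficients are real parts of the Taylor coefficients of
      \<open>F\<close>, so the series of \<open>F\<close> dominates termwise.\<close>
    have "\<bar>Re ((deriv ^^ k) F 0)\<bar> / fact k * norm z ^ k \<le> norm ((deriv ^^ k) F 0) / fact k * norm z ^ k"
      by (intro mult_right_mono divide_right_mono abs_Re_le_cmod) auto
    then show "norm (complex_of_real (vcoeff d lam k (2*pi)) * z ^ k) \<le> norm ((deriv ^^ k) F 0 / fact k * z ^ k)"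
      by (simp add: coeff norm_mult norm_divide norm_power)
  qed
  then show "summable (\<lambda>k. complex_of_real (vcoeff d lam (k + 2) (2 * pi)) * z ^ (k + 2))"
    by (rule summable_ignore_initial_segment)
qed

end
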